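(* Let $q$ be a prime power with $q\equiv 1 \pmod 4$, $3\mid (q-1)$ and $q>2809$, and let $n=1+\frac{q-1}{3}$. Then there exists an element of $\mathbb{F}_q$ that cannot be written as $\alpha+\beta$ with $\alpha\in C_5$ and $\beta\in C_n$.
   Context: For a prime power $q$ and an integer $k>1$, an element $a\in\mathbb{F}_q$ is called a $k$-potent if $a^k=a$, and $C_k$ denotes the set of all $k$-potents in $\mathbb{F}_q$. For $n=1+(q-1)/3$, $C_n$ is the set of cubes in $\mathbb{F}_q$, including $0$. *)

theory Defs
  imports Main
begin

definition potents :: "nat \<Rightarrow> 'a::field set" where
  "potents k = {a. a ^ k = a}"

end

(*
  The statement is a Weil bound in disguise: expanding prod_c (2 - chi(c - x) - chi(c - x)^2) over five
  points c, for a cubic character chi, gives main term 32 q and error at most 32 * 49 * sqrt q.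

  The Weil bound for S_1 = sum_x chi(prod_c (c - x)^(e c)) comes from the L-function
  L(T) = sum over monic g of chi(prod_c g(c)^(e c)) T^(deg g). By Lagrange interpolation it is a polynomial
  of degree < |C|, and Newton's identities express its inverse roots through the corresponding
  sums S_n over the extensions F_(q^n), all taken inside the algebraic closure. It remains to see S_(2k) = O(q^k).
  With r = q^k, this follows from Stepanov's method in Bombieri's form: a linear
  dependency in the r-th powers of the coefficients yields a polynomial H of degree about r^2/3 whose r-th
  power vanishes wherever the character takes a prescribed value.
*)
theory Submission
  imports
    Defs
    "HOL-Algebra.Algebraic_Closure_Type"
    "HOL-Computational_Algebra.Computational_Algebra"
    "HOL-Analysis.Kronecker_Approximation_Theorem"
begin

section \<open>Power sums and inverse roots\<close>

text \<open>The five points are the elements of \<open>potents 5\<close>, padded if there are fewer.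
  As this set is stable under negation, \<open>- x\<close> misses the sumset as soon as no
  \<open>c - x\<close> is 0 or a cube. The factor 2 - chi - chi^2 is 0 at nonzero cubes, 3 at
  noncubes and 2 at 0, so if every x outside the points fails, the sum of the products stays bounded
  while its main term grows. Stepanov's method bounds numbers of solutions only from above, over
  fields of square order, and with a constant too large for direct use. The remedies shape the
  proof. The three classes of the cubic character fill the field up to a few zeros, so upper bounds
  for all of them give lower bounds too. The constant disappears because the estimate holds for
  every k: simultaneous Diophantine approximation prevents the power sums of the inverse roots from
  cancelling. Even indices suffice because they control the squares of the inverse roots.\<close>

lemma norm_le_1_if_power_sums_bounded:
  fixes z :: "nat \<Rightarrow> complex"
  assumes bounded: "\<And>k. k \<ge> 1 \<Longrightarrow> norm (\<Sum>l<n. z l ^ k) \<le> B" and i: "i < n"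
  shows "norm (z i) \<le> 1"
proof (rule ccontr)
  assume "\<not> norm (z i) \<le> 1"
  hence big: "norm (z i) > 1" by simp
  obtain M where M: "2 * B < norm (z i) ^ M"
    using real_arch_pow[OF big] by blast
  define m where "m = Suc M"
  have m: "2 * B < norm (z i) ^ m"
    using M big power_increasing[of M m "norm (z i)"] by (simp add: m_def)
  \<comment> \<open>Approximation with denominator 6 turns all arguments at once to within
    \<open>2 * pi / 6 = pi / 3\<close> of full turns, where the cosine is at least 1/2, so the
    powers cannot cancel. The factor \<open>m\<close> in the exponent keeps it large even if
    \<open>t = 1\<close>.\<close>
  obtain t p where t: "0 < t"
    and p: "\<And>l. l < n \<Longrightarrow> \<bar>of_int t * (real m * Arg (z l) / (2 * pi)) - of_int (p l)\<bar> < 1 / real 6"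
    by (rule Dirichlet_approx_simult[of 6 n "\<lambda>l. real m * Arg (z l) / (2 * pi)"]) auto
  define k where "k = m * nat t"
  have k: "k \<ge> m" "k \<ge> 1" using t mult_le_mono2[of 1 "nat t" m] by (auto simp: k_def m_def)
  have half: "norm (z l) ^ k / 2 \<le> Re (z l ^ k)" if l: "l < n" for l
  proof -
    define \<delta> where "\<delta> = real k * Arg (z l) - 2 * pi * of_int (p l)"
    have "\<delta> = 2 * pi * (of_int t * (real m * Arg (z l) / (2 * pi)) - of_int (p l))"
      using t by (simp add: \<delta>_def k_def field_simps)
    hence "\<bar>\<delta>\<bar> = 2 * pi * \<bar>of_int t * (real m * Arg (z l) / (2 * pi)) - of_int (p l)\<bar>"
      by (simp add: abs_mult)
    also have "\<dots> \<le> 2 * pi * (1 / real 6)"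
      by (intro mult_left_mono less_imp_le[OF p[OF l]]) auto
    finally have "\<bar>\<delta>\<bar> \<le> pi / 3" by simp
    hence "cos (pi / 3) \<le> cos \<bar>\<delta>\<bar>"
      using pi_gt_zero by (intro cos_monotone_0_pi_le) (auto simp del: pi_gt_zero)
    moreover have "cos (real k * Arg (z l)) = cos \<delta>"
    proof -
      have "real k * Arg (z l) = \<delta> + 2 * pi * of_int (p l)" by (simp add: \<delta>_def)
      thus ?thesis by (simp add: cos_add)
    qed
    ultimately have "1 / 2 \<le> cos (real k * Arg (z l))"
      by (simp add: cos_60)
    hence "norm (z l) ^ k * (1 / 2) \<le> norm (z l) ^ k * cos (real k * Arg (z l))"
      by (intro mult_left_mono) auto
    also have "\<dots> = Re (rcis (norm (z l)) (Arg (z l)) ^ k)"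
      by (subst DeMoivre2) simp
    also have "\<dots> = Re (z l ^ k)" by (simp add: rcis_cmod_Arg)
    finally show ?thesis by simp
  qed
  have "B < norm (z i) ^ k / 2"
    using m power_increasing[OF k(1), of "norm (z i)"] big by linarith
  also have "\<dots> \<le> Re (z i ^ k)" by (rule half[OF i])
  also have "\<dots> \<le> (\<Sum>l<n. Re (z l ^ k))"
  proof (rule member_le_sum)
    fix l assume "l \<in> {..<n} - {i}"
    thus "0 \<le> Re (z l ^ k)" using half[of l] by (smt (verit) DiffD1 divide_nonneg_pos lessThan_iff norm_ge_zero zero_le_power)
  qed (use i in auto)
  also have "\<dots> = Re (\<Sum>l<n. z l ^ k)" by simp
  also have "\<dots> \<le> norm (\<Sum>l<n. z l ^ k)" by (rule complex_Re_le_cmod)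
  also have "\<dots> \<le> B" by (rule bounded[OF k(2)])
  finally show False by simp
qed

text \<open>The series T L'(T) / L(T), where L is the product of 1 - x T over \<open>A\<close>.
  Hence the constant term 0 instead of the size of \<open>A\<close>.\<close>

definition neg_power_sums :: "complex multiset \<Rightarrow> complex fps" where
  "neg_power_sums A = Abs_fps (\<lambda>n. if n = 0 then 0 else - (\<Sum>x\<in>#A. x ^ n))"

text \<open>Logarithmic derivatives add over products, and a factor 1 - x T contributes the
  geometric series of -x T / (1 - x T). With denominators cleared, the induction is the Leibniz
  rule.\<close>

lemma log_deriv_prod_linear:
  "fps_X * fps_deriv (fps_of_poly (\<Prod>x\<in>#A. [:1, -x:])) =
     neg_power_sums A * fps_of_poly (\<Prod>x\<in>#A. [:1, -x:])"
proof (induction A)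
  case empty
  show ?case by (simp add: neg_power_sums_def fps_eq_iff)
next
  case (add x A)
  let ?L = "fps_of_poly (\<Prod>x\<in>#A. [:1, -x:])" and ?l = "1 - fps_const x * fps_X :: complex fps"
  have l: "fps_of_poly [:1, -x:] = ?l"
    by (simp add: fps_of_poly_pCons fps_of_poly_linear mult.commute)
  have split: "neg_power_sums (add_mset x A) = neg_power_sums {#x#} + neg_power_sums A"
    by (rule fps_ext) (simp add: neg_power_sums_def)
  have "neg_power_sums {#x#} * ?l = - (fps_const x * fps_X)"
  proof (rule fps_ext)
    fix n
    have "neg_power_sums {#x#} * ?l = neg_power_sums {#x#} - fps_const x * (fps_X * neg_power_sums {#x#})"
      by (simp add: algebra_simps)
    hence "fps_nth (neg_power_sums {#x#} * ?l) n =
           fps_nth (neg_power_sums {#x#} - fps_const x * (fps_X * neg_power_sums {#x#})) n" by simp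
    also have "\<dots> = fps_nth (- (fps_const x * fps_X)) n"
      by (cases n) (auto simp: neg_power_sums_def fps_X_nth)
    finally show "fps_nth (neg_power_sums {#x#} * ?l) n = fps_nth (- (fps_const x * fps_X)) n" .
  qed
  moreover have "fps_deriv ?l = - fps_const x" by simp
  ultimately have one: "fps_X * fps_deriv ?l = neg_power_sums {#x#} * ?l" by (simp add: mult.commute)
  have "fps_X * fps_deriv (?l * ?L) = fps_X * fps_deriv ?l * ?L + ?l * (fps_X * fps_deriv ?L)"
    by (simp add: algebra_simps)
  also have "\<dots> = neg_power_sums (add_mset x A) * (?l * ?L)"
    unfolding one add.IH split by (simp add: algebra_simps)
  finally show ?case by (simp only: image_mset_add_mset prod_mset.add_mset fps_of_poly_mult l)
qed

lemma reflect_poly_prod_mset: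
  fixes f :: "'b \<Rightarrow> 'a::{comm_semiring_1,semiring_no_zero_divisors} poly"
  shows "reflect_poly (\<Prod>x\<in>#A. f x) = (\<Prod>x\<in>#A. reflect_poly (f x))"
  by (induction A) (simp_all add: reflect_poly_mult)

text \<open>By \<open>newton\<close>, the \<open>S n\<close> are the coefficients of T L'(T) / L(T)
  for the polynomial L with coefficients \<open>s\<close>, so \<open>S n\<close> is minus the sum of
  the n-th powers of the inverse roots. There are at most \<open>d - 1\<close> of these, and each
  has norm at most \<open>sqrt R\<close>; \<open>B\<close> drops out because the bound holds for all
  \<open>k\<close>.\<close>

lemma newton_bound:
  fixes s S :: "nat \<Rightarrow> complex"
  assumes s0: "s 0 = 1" and d: "d \<ge> 1" and s_zero: "\<And>n. n \<ge> d \<Longrightarrow> s n = 0"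
    and newton: "\<And>n. n \<ge> 1 \<Longrightarrow> of_nat n * s n = (\<Sum>k=1..n. S k * s (n - k))"
    and R: "R > 0" and S_bound: "\<And>k. k \<ge> 1 \<Longrightarrow> norm (S (2 * k)) \<le> B * R ^ k"
  shows "norm (S 1) \<le> real (d - 1) * sqrt R"
proof -
  define L where "L = Poly (map s [0..<d])"
  have coeff_L: "poly.coeff L n = s n" for n
    using s_zero by (auto simp: L_def nth_default_def)
  have "poly.coeff L 0 \<noteq> 0" using s0 by (simp add: coeff_L)
  hence LL: "reflect_poly (reflect_poly L) = L" and [simp]: "L \<noteq> 0" by auto
  have deg_L: "Polynomial.degree L \<le> d - 1"
    by (rule degree_le) (use d in \<open>auto simp: coeff_L intro: s_zero\<close>)
  \<comment> \<open>Roots of the reversed polynomial are the inverse roots of \<open>L\<close>, and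
    \<open>s 0 = 1\<close> makes it monic.\<close>
  obtain A where A: "size A = Polynomial.degree (reflect_poly L)"
    "reflect_poly L = Polynomial.smult (Polynomial.lead_coeff (reflect_poly L)) (\<Prod>x\<in>#A. [:-x, 1:])"
    using alg_closed_imp_factorization[of "reflect_poly L"] by auto
  have "poly.coeff L 0 \<noteq> 0" using s0 by (simp add: coeff_L)
  hence "Polynomial.lead_coeff (reflect_poly L) = 1"
    by (simp add: coeff_reflect_poly degree_reflect_poly_eq coeff_L s0)
  hence "L = reflect_poly (\<Prod>x\<in>#A. [:-x, 1:])" using A(2) LL by simp
  also have "\<dots> = (\<Prod>x\<in>#A. [:1, -x:])"
  proof -
    have "reflect_poly [:-x, 1:] = [:1, -x:]" for x :: complex
      by (cases "x = 0") (auto simp: reflect_poly_def)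
    thus ?thesis by (simp add: reflect_poly_prod_mset)
  qed
  finally have L: "L = (\<Prod>x\<in>#A. [:1, -x:])" .
  have size_A: "size A \<le> d - 1"
    using A(1) deg_L degree_reflect_poly_le[of L] by linarith
  let ?T = "fps_nth (neg_power_sums A)"
  have T_newton: "of_nat n * s n = (\<Sum>k=1..n. ?T k * s (n - k))" if n: "n \<ge> 1" for n
  proof -
    have "fps_nth (fps_X * fps_deriv (fps_of_poly L)) n = fps_nth (neg_power_sums A * fps_of_poly L) n"
      using log_deriv_prod_linear[of A] L by simp
    also have "\<dots> = (\<Sum>k=0..n. ?T k * s (n - k))" by (simp add: fps_mult_nth coeff_L)
    also have "\<dots> = (\<Sum>k=1..n. ?T k * s (n - k))"
      by (simp add: sum.atLeast_Suc_atMost neg_power_sums_def)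
    also have "fps_nth (fps_X * fps_deriv (fps_of_poly L)) n = of_nat n * s n"
      using n by (cases n) (auto simp: coeff_L)
    finally show ?thesis .
  qed
  have ST: "S n = ?T n" if "n \<ge> 1" for n
    using that
  proof (induction n rule: less_induct)
    case (less n)
    have split: "(\<Sum>k=1..n. f k * s (n - k)) = f n + (\<Sum>k\<in>{1..<n}. f k * s (n - k))" for f
    proof -
      have "{1..n} = insert n {1..<n}" using less.prems by auto
      thus ?thesis by (simp add: s0)
    qed
    have "(\<Sum>k\<in>{1..<n}. S k * s (n - k)) = (\<Sum>k\<in>{1..<n}. ?T k * s (n - k))"
      by (intro sum.cong) (auto simp: less.IH)
    thus ?case
      using newton[OF less.prems] T_newton[OF less.prems] split[of S] split[of ?T] by auto
  qed
  obtain xs where xs: "A = mset xs" using ex_mset[of A] by auto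
  define l where "l = length xs"
  have l: "l \<le> d - 1" using size_A by (simp add: xs l_def)
  have sum_A: "(\<Sum>x\<in>#A. f x) = (\<Sum>i<l. f (xs ! i))" for f :: "complex \<Rightarrow> complex"
  proof -
    have "(\<Sum>x\<in>#A. f x) = sum_list (map f xs)" by (metis xs mset_map sum_mset_sum_list)
    also have "\<dots> = (\<Sum>i<l. f (xs ! i))" by (simp add: sum_list_sum_nth l_def atLeast0LessThan)
    finally show ?thesis .
  qed
  have le: "norm (xs ! i) \<le> sqrt R" if i: "i < l" for i
  proof -
    \<comment> \<open>Squaring, because only the even indices are controlled; division by
      \<open>R\<close> turns the growth \<open>R ^ k\<close> into a constant.\<close>
    define z where "z i = (xs ! i)\<^sup>2 / of_real R" for i
    have "norm (\<Sum>i<l. z i ^ k) \<le> B" if k: "k \<ge> 1" for k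
    proof -
      have "(\<Sum>i<l. z i ^ k) = - S (2 * k) / of_real R ^ k"
        using ST[of "2 * k"] k
        by (simp add: neg_power_sums_def sum_A z_def power_divide sum_divide_distrib flip: power_mult)
      hence "norm (\<Sum>i<l. z i ^ k) = norm (S (2 * k)) / R ^ k"
        using R by (simp add: norm_divide norm_power)
      also have "\<dots> \<le> B" using S_bound[OF k] R by (simp add: field_simps)
      finally show ?thesis .
    qed
    hence "norm (z i) \<le> 1" by (rule norm_le_1_if_power_sums_bounded[OF _ i])
    hence "norm (xs ! i) ^ 2 \<le> R" using R by (simp add: z_def norm_divide norm_power)
    thus ?thesis by (rule real_le_rsqrt)
  qed
  have "norm (S 1) = norm (\<Sum>i<l. xs ! i)"
    using ST[of 1] by (simp add: neg_power_sums_def) (simp add: sum_A[of "\<lambda>x. x", simplified])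
  also have "\<dots> \<le> real (card {..<l}) * sqrt R" 
    using sum_norm_bound[of "{..<l}" "\<lambda>i. xs ! i" "sqrt R"] le by simp
  also have "\<dots> \<le> real (d - 1) * sqrt R" using l R by (intro mult_right_mono) auto
  finally show ?thesis .
qed

section \<open>Powers acting as Frobenius maps\<close>

lemma proots_prod_linear: "proots (\<Prod>x\<in>#A. [:-x, 1 :: 'k::idom:]) = A"
proof -
  have "(0 :: 'k poly) \<notin># {#[:-x, 1:]. x \<in># A#}" by auto
  from proots_prod_mset[OF this] show ?thesis by (simp add: image_mset.compositionality o_def)
qed

lemma poly_eq_prod_proots:
  fixes p :: "'k::alg_closed_field poly"
  assumes "p \<noteq> 0"
  shows "p = Polynomial.smult (Polynomial.lead_coeff p) (\<Prod>x\<in>#proots p. [:-x, 1:])"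
proof -
  obtain A where A: "p = Polynomial.smult (Polynomial.lead_coeff p) (\<Prod>x\<in>#A. [:-x, 1:])"
    using alg_closed_imp_factorization[OF assms] by blast
  with assms show ?thesis by (metis leading_coeff_neq_0 proots_prod_linear proots_smult)
qed

lemma size_proots:
  fixes p :: "'k::alg_closed_field poly"
  assumes "p \<noteq> 0"
  shows "size (proots p) = Polynomial.degree p"
proof -
  obtain A where "size A = Polynomial.degree p"
    and A: "p = Polynomial.smult (Polynomial.lead_coeff p) (\<Prod>x\<in>#A. [:-x, 1:])"
    using alg_closed_imp_factorization[OF assms] by blast
  with assms show ?thesis by (metis leading_coeff_neq_0 proots_prod_linear proots_smult)
qed

text \<open>Additivity of the \<open>q\<close>-th power and the vanishing of \<open>q\<close> are
  what is retained of \<open>q\<close> being a power of the characteristic. Both pass to every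
  \<open>q ^ n\<close>, so the extension of degree \<open>n\<close> is the set fixed by the
  \<open>q ^ n\<close>-th power, and all extensions live in one type.\<close>

locale frobenius =
  fixes K :: "'k::alg_closed_field itself" and q :: nat
  assumes frob_add: "(x + y) ^ q = x ^ q + (y :: 'k) ^ q"
    and of_nat_q: "of_nat q = (0 :: 'k)"
    and q_gt_1: "q > 1"
begin

definition fixed :: "'k set" where
  "fixed = {x. x ^ q = x}"

definition fixed_poly :: "'k poly set" where
  "fixed_poly = {p. \<forall>i. poly.coeff p i \<in> fixed}"

lemma frob_sum: "(\<Sum>i\<in>A. f i) ^ q = (\<Sum>i\<in>A. (f i :: 'k) ^ q)"
  using q_gt_1 by (induction A rule: infinite_finite_induct) (auto simp: frob_add)

lemma frob_diff: "(x - y) ^ q = x ^ q - (y :: 'k) ^ q"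
  using frob_add[of "x - y" y] by simp

lemma frob_inj: "x ^ q = (y :: 'k) ^ q \<Longrightarrow> x = y"
  using frob_diff[of x y] by simp

lemma fixed_0 [simp]: "0 \<in> fixed" and fixed_1 [simp]: "1 \<in> fixed"
  using q_gt_1 by (auto simp: fixed_def)

lemma fixed_mult [simp]: "x \<in> fixed \<Longrightarrow> y \<in> fixed \<Longrightarrow> x * y \<in> fixed"
  by (auto simp: fixed_def power_mult_distrib)

lemma fixed_add [simp]: "x \<in> fixed \<Longrightarrow> y \<in> fixed \<Longrightarrow> x + y \<in> fixed"
  by (auto simp: fixed_def frob_add)

lemma fixed_diff [simp]: "x \<in> fixed \<Longrightarrow> y \<in> fixed \<Longrightarrow> x - y \<in> fixed"
  by (auto simp: fixed_def frob_diff)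

lemma fixed_uminus [simp]: "x \<in> fixed \<Longrightarrow> - x \<in> fixed"
  using fixed_diff[of 0 x] by simp

lemma fixed_divide [simp]: "x \<in> fixed \<Longrightarrow> y \<in> fixed \<Longrightarrow> x / y \<in> fixed"
  by (auto simp: fixed_def power_divide)

lemma fixed_power [simp]: "x \<in> fixed \<Longrightarrow> x ^ n \<in> fixed"
  by (auto simp: fixed_def simp flip: power_mult) (metis mult.commute power_mult)

lemma fixed_sum: "(\<And>i. i \<in> A \<Longrightarrow> f i \<in> fixed) \<Longrightarrow> sum f A \<in> fixed"
  by (induction A rule: infinite_finite_induct) auto

lemma fixed_prod: "(\<And>i. i \<in> A \<Longrightarrow> f i \<in> fixed) \<Longrightarrow> prod f A \<in> fixed"
  by (induction A rule: infinite_finite_induct) auto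

lemma fixed_poly_mult: "p \<in> fixed_poly \<Longrightarrow> r \<in> fixed_poly \<Longrightarrow> p * r \<in> fixed_poly"
  by (auto simp: fixed_poly_def coeff_mult intro: fixed_sum)

lemma fixed_poly_add: "p \<in> fixed_poly \<Longrightarrow> r \<in> fixed_poly \<Longrightarrow> p + r \<in> fixed_poly"
  by (auto simp: fixed_poly_def)

lemma fixed_poly_smult: "x \<in> fixed \<Longrightarrow> p \<in> fixed_poly \<Longrightarrow> Polynomial.smult x p \<in> fixed_poly"
  by (auto simp: fixed_poly_def)

lemma fixed_poly_1 [simp]: "1 \<in> fixed_poly"
  by (auto simp: fixed_poly_def)

lemma fixed_poly_0 [simp]: "0 \<in> fixed_poly"
  by (auto simp: fixed_poly_def)

lemma fixed_poly_linear [simp]: "x \<in> fixed \<Longrightarrow> y \<in> fixed \<Longrightarrow> [:x, y:] \<in> fixed_poly"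
  by (auto simp: fixed_poly_def coeff_pCons split: nat.splits)

lemma fixed_poly_monom [simp]: "x \<in> fixed \<Longrightarrow> Polynomial.monom x n \<in> fixed_poly"
  by (auto simp: fixed_poly_def)

lemma fixed_poly_power: "p \<in> fixed_poly \<Longrightarrow> p ^ n \<in> fixed_poly"
  by (induction n) (auto intro: fixed_poly_mult)

lemma fixed_poly_prod: "(\<And>i. i \<in> A \<Longrightarrow> f i \<in> fixed_poly) \<Longrightarrow> prod f A \<in> fixed_poly"
  by (induction A rule: infinite_finite_induct) (auto intro: fixed_poly_mult)

lemma fixed_poly_sum: "(\<And>i. i \<in> A \<Longrightarrow> f i \<in> fixed_poly) \<Longrightarrow> sum f A \<in> fixed_poly"
  by (induction A rule: infinite_finite_induct) (auto intro: fixed_poly_add)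

lemma poly_fixed: "p \<in> fixed_poly \<Longrightarrow> x \<in> fixed \<Longrightarrow> poly p x \<in> fixed"
  by (auto simp: poly_altdef fixed_poly_def intro!: fixed_sum)

text \<open>X^q - X has derivative -1, hence only simple roots, and over an algebraically closed
  field their number is the degree.\<close>

lemma card_fixed: "card fixed = q" and finite_fixed [simp]: "finite fixed"
proof -
  define P :: "'k poly" where "P = Polynomial.monom 1 q - [:0, 1:]"
  have "poly.coeff P q = 1" using q_gt_1 by (simp add: P_def coeff_pCons split: nat.splits)
  hence nz: "P \<noteq> 0" by auto
  have deg: "Polynomial.degree P = q"
    unfolding P_def diff_conv_add_uminus using q_gt_1
    by (subst degree_add_eq_left) (auto simp: degree_monom_eq)
  have roots: "{x. poly P x = 0} = fixed"
    by (auto simp: P_def fixed_def poly_monom)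
  have deriv: "pderiv P = -1"
    using of_nat_q by (simp add: P_def pderiv_diff pderiv_monom pderiv_pCons one_pCons)
  have "Polynomial.order x P \<le> 1" for x
  proof (rule ccontr)
    assume "\<not> Polynomial.order x P \<le> 1"
    hence "[:-x, 1:] ^ 2 dvd P" by (intro order_divides[THEN iffD2]) auto
    then obtain h where "P = [:-x, 1:] * ([:-x, 1:] * h)"
      by (metis dvdE mult.assoc power2_eq_square)
    hence "poly (pderiv P) x = 0" by (simp only: pderiv_mult) simp
    thus False by (simp add: deriv)
  qed
  hence "count (proots P) x \<le> 1" for x using nz by simp
  hence "proots P = mset_set fixed"
    using nz roots poly_roots_finite[OF nz]
    by (intro multiset_eqI) (metis One_nat_def count_eq_zero_iff count_mset_set(1,3) le_Suc_eq le_zero_eq set_count_proots)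
  thus "card fixed = q" using size_proots[OF nz] deg by simp
  show "finite fixed" using poly_roots_finite[OF nz] roots by simp
qed

lemma card_fixed_poly_bounded_degree:
  "finite {p \<in> fixed_poly. \<forall>i\<ge>n. poly.coeff p i = 0}" (is "finite ?P")
  "card {p \<in> fixed_poly. \<forall>i\<ge>n. poly.coeff p i = 0} \<le> q ^ n"
proof -
  let ?h = "\<lambda>p :: 'k poly. restrict (poly.coeff p) {..<n}"
  have inj: "inj_on ?h ?P"
  proof (rule inj_onI)
    fix p r assume pr: "p \<in> ?P" "r \<in> ?P" "?h p = ?h r"
    show "p = r"
    proof (rule poly_eqI)
      fix i show "poly.coeff p i = poly.coeff r i"
      proof (cases "i < n")
        case True thus ?thesis using fun_cong[OF pr(3), of i] by simp
      qed (use pr in auto)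
    qed
  qed
  have sub: "?h ` ?P \<subseteq> (\<Pi>\<^sub>E i\<in>{..<n}. fixed)"
    by (auto simp: fixed_poly_def split: if_splits)
  have fin: "finite (\<Pi>\<^sub>E i\<in>{..<n}. fixed)" by (intro finite_PiE) auto
  have "card ?P = card (?h ` ?P)" using inj by (simp add: card_image)
  also have "\<dots> \<le> card (\<Pi>\<^sub>E i\<in>{..<n}. fixed)" by (intro card_mono sub fin)
  also have "\<dots> = q ^ n" by (simp add: card_PiE card_fixed)
  finally show "card ?P \<le> q ^ n" .
  show "finite ?P" using inj sub fin by (meson finite_imageD finite_subset)
qed

lemma fixed_power_q: "x \<in> fixed \<Longrightarrow> x ^ (q ^ n) = x"
  by (induction n) (auto simp: fixed_def power_mult)

lemma frobenius_power:
  assumes "n > 0"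
  shows "frobenius TYPE('k) (q ^ n)"
proof
  fix x y :: 'k
  show "(x + y) ^ (q ^ n) = x ^ (q ^ n) + y ^ (q ^ n)"
    by (induction n) (auto simp: power_mult frob_add mult.commute[of q])
next
  show "of_nat (q ^ n) = (0::'k)" using of_nat_q \<open>n > 0\<close> by simp
next
  show "q ^ n > 1" using one_less_power[OF q_gt_1 \<open>n > 0\<close>] .
qed

end

section \<open>The cubic residue character\<close>

locale cubic_frobenius = frobenius K q for K :: "'k::alg_closed_field itself" and q +
  fixes w :: 'k
  assumes w: "w\<^sup>2 + w + 1 = 0" and q_mod_3: "q mod 3 = 1"
begin

lemma cubic_frobenius_power: "n > 0 \<Longrightarrow> cubic_frobenius (q ^ n) w"
proof -
  assume "n > 0"
  then interpret P: frobenius "TYPE('k)" "q ^ n" by (rule frobenius_power)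
  show ?thesis by unfold_locales (use w q_mod_3 in \<open>auto simp: power_mod[symmetric, of q]\<close>)
qed

lemma three_nz: "(3 :: 'k) \<noteq> 0"
proof
  assume "(3::'k) = 0"
  have "q = 3 * (q div 3) + 1" using q_mod_3 by presburger
  hence "of_nat q = (3 * of_nat (q div 3) + 1 :: 'k)" 
    by (metis of_nat_1 of_nat_add of_nat_mult of_nat_numeral)
  with \<open>3 = 0\<close> of_nat_q show False by simp
qed

lemma w_sq: "w\<^sup>2 = - w - 1"
  using w by (simp add: eq_neg_iff_add_eq_0 algebra_simps)

lemma w_cube: "w ^ 3 = 1"
proof -
  have "w ^ 3 - 1 = (w - 1) * (w\<^sup>2 + w + 1)" by (simp add: algebra_simps power2_eq_square power3_eq_cube)
  thus ?thesis using w by simp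
qed

lemma w_ne: "w \<noteq> 1" "w \<noteq> 0" "w\<^sup>2 \<noteq> 1" "w\<^sup>2 \<noteq> w" "w\<^sup>2 \<noteq> 0"
proof -
  show 1: "w \<noteq> 1" using w three_nz by auto
  show 0: "w \<noteq> 0" using w by auto
  show "w\<^sup>2 \<noteq> 1" using w_cube 1 by (metis mult_1 power2_eq_square power3_eq_cube)
  show "w\<^sup>2 \<noteq> w" using 0 1 by (auto simp: power2_eq_square)
  show "w\<^sup>2 \<noteq> 0" using 0 by simp
qed

lemma cube_root_cases: "y ^ 3 = 1 \<Longrightarrow> y = 1 \<or> y = w \<or> y = w\<^sup>2"
proof -
  assume y: "y ^ 3 = 1"
  have "(y - 1) * ((y - w) * (y - w\<^sup>2)) = (y - 1) * (y\<^sup>2 - (w + w\<^sup>2) * y + w ^ 3)"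
    by (simp add: algebra_simps power2_eq_square power3_eq_cube)
  also have "\<dots> = y ^ 3 - 1" unfolding w_cube w_sq by (simp add: algebra_simps power2_eq_square power3_eq_cube)
  finally have "(y - 1) * ((y - w) * (y - w\<^sup>2)) = 0" using y by simp
  thus ?thesis by auto
qed

lemma w_fixed [simp]: "w \<in> fixed"
proof -
  have "w ^ q = w ^ (3 * (q div 3) + q mod 3)" by simp
  also have "\<dots> = w" unfolding q_mod_3 power_add power_mult w_cube by simp
  finally show ?thesis by (simp add: fixed_def)
qed

text \<open>Identifies the cube roots of unity of \<open>'k\<close> with the complex ones; the
  default value gives \<open>chi 0 = 0\<close>.\<close>

definition chi :: "'k \<Rightarrow> complex" where
  "chi y = (if y = 1 then 1 else if y = w then cis (2 * pi / 3)
          else if y = w\<^sup>2 then cis (2 * pi / 3) ^ 2 else 0)"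

lemma cis_cube: "cis (2 * pi / 3) ^ 3 = 1"
  unfolding Complex.DeMoivre by simp

lemma chi_1 [simp]: "chi 1 = 1" and chi_0 [simp]: "chi 0 = 0"
  and chi_w: "chi w = cis (2 * pi / 3)" and chi_w2: "chi (w\<^sup>2) = cis (2 * pi / 3) ^ 2"
  using w_ne by (auto simp: chi_def)

lemma sum_cube_roots: "1 + cis (2 * pi / 3) + cis (2 * pi / 3) ^ 2 = 0"
proof -
  let ?z = "cis (2 * pi / 3)"
  have "?z \<noteq> 1" using sin_120 by (auto simp: complex_eq_iff)
  moreover have "(?z - 1) * (1 + ?z + ?z ^ 2) = 0"
    using cis_cube by (simp add: algebra_simps power2_eq_square power3_eq_cube)
  ultimately show ?thesis by simp
qed

lemma norm_chi: "norm (chi y) \<le> 1"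
  by (simp add: chi_def norm_power)

lemma chi_mult: "chi (x * y) = chi x * chi y"
  if "x = 0 \<or> x ^ 3 = 1" "y = 0 \<or> y ^ 3 = 1"
proof -
  let ?z = "cis (2 * pi / 3)"
  have w4: "w\<^sup>2 * w\<^sup>2 = w" "w * w\<^sup>2 = 1" "w\<^sup>2 * w = 1" "w * w = w\<^sup>2"
    using w_cube by (simp_all add: power2_eq_square power3_eq_cube mult.assoc)
  have z4: "?z\<^sup>2 * ?z\<^sup>2 = ?z" "?z * ?z\<^sup>2 = 1" "?z\<^sup>2 * ?z = 1" "?z * ?z = ?z\<^sup>2"
    using cis_cube by (simp_all add: power2_eq_square power3_eq_cube mult.assoc)
  have "x \<in> {0, 1, w, w\<^sup>2}" "y \<in> {0, 1, w, w\<^sup>2}"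
    using that cube_root_cases by auto
  thus ?thesis by (elim insertE emptyE) (simp_all only: w4 z4 chi_w chi_w2 chi_0 chi_1 mult_1_left mult_1_right mult_zero_left mult_zero_right)
qed

lemma q_sub_1: "3 * ((q - 1) div 3) = q - 1"
  using q_mod_3 q_gt_1 by presburger

lemma fixed_power_third:
  assumes "x \<in> fixed"
  shows "x ^ ((q - 1) div 3) = 0 \<or> (x ^ ((q - 1) div 3)) ^ 3 = 1"
proof (cases "x = 0")
  case True
  have "(q - 1) div 3 > 0" using q_sub_1 q_gt_1 by (cases "(q - 1) div 3") auto
  thus ?thesis using True by simp
next
  case False
  have "x * x ^ (q - 1) = x" using assms q_gt_1 by (simp add: fixed_def power_eq_if)
  hence "x ^ (q - 1) = 1" using False by simp
  hence "(x ^ ((q - 1) div 3)) ^ 3 = 1"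
    by (simp only: power_mult[symmetric] mult.commute[of _ 3] q_sub_1)
  thus ?thesis ..
qed

text \<open>Euler's criterion: on nonzero elements of \<open>fixed\<close> this power is a cube root
  of unity, and it is 1 exactly at the nonzero cubes.\<close>

definition cubic_char :: "'k \<Rightarrow> complex" where
  "cubic_char x = chi (x ^ ((q - 1) div 3))"

lemma cubic_char_mult:
  "x \<in> fixed \<Longrightarrow> y \<in> fixed \<Longrightarrow> cubic_char (x * y) = cubic_char x * cubic_char y"
  unfolding cubic_char_def power_mult_distrib by (intro chi_mult fixed_power_third)

lemma cubic_char_1 [simp]: "cubic_char 1 = 1"
  by (simp add: cubic_char_def)

lemma cubic_char_power: "x \<in> fixed \<Longrightarrow> cubic_char (x ^ n) = cubic_char x ^ n"
  by (induction n) (auto simp: cubic_char_mult)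

lemma cubic_char_prod:
  "(\<And>i. i \<in> A \<Longrightarrow> f i \<in> fixed) \<Longrightarrow> cubic_char (\<Prod>i\<in>A. f i) = (\<Prod>i\<in>A. cubic_char (f i))"
  by (induction A rule: infinite_finite_induct) (auto simp: cubic_char_mult fixed_prod)

end

section \<open>Stepanov's method\<close>

text \<open>\<open>a\<close> and \<open>b\<close> agree modulo \<open>r\<close> and both lie below
  \<open>2 * r\<close>, so the quotients differ by at most 1. This separates vanishing orders in
  \<open>stepanov\<close>.\<close>

lemma residue_cases:
  fixes r :: nat
  assumes "r * i + a = r * i' + b" "a < 2 * r" "b < 2 * r"
  shows "a = b \<or> a = b + r \<or> b = a + r"
proof -
  have *: "c = d \<or> c = d + r" if "r * k + c = r * k' + d" "k \<le> k'" "c < 2 * r" for k k' c d :: nat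
  proof -
    obtain t where t: "k' = k + t" using \<open>k \<le> k'\<close> le_Suc_ex by blast
    hence c: "c = r * t + d" using that by (simp add: algebra_simps)
    show ?thesis
    proof (cases "t \<ge> 2")
      case True
      hence "r * 2 \<le> r * t" by (intro mult_le_mono2)
      thus ?thesis using c that by linarith
    next
      case False
      hence "t = 0 \<or> t = 1" by auto
      thus ?thesis using c by auto
    qed
  qed
  show ?thesis using *[OF assms(1)] *[OF assms(1)[symmetric]] assms by (cases "i \<le> i'") auto
qed

context cubic_frobenius
begin

text \<open>Here \<open>q\<close> is the square root of the order of the field.\<close>

lemma stepanov:
  fixes f g :: "'k poly"
  assumes q: "q = 3 * s + 1" and s: "s \<ge> 5"
    and f: "f = [:0, 1:] ^ e * g" and g: "poly g 0 \<noteq> 0" and e: "e = 1 \<or> e = 2"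
    and f_fixed: "\<And>i. poly.coeff f i ^ (q\<^sup>2) = poly.coeff f i"
    and u: "u ^ 3 = 1"
  shows "card {x. x ^ (q\<^sup>2) = x \<and> poly f x ^ ((q\<^sup>2 - 1) div 3) = u}
           \<le> 3 * s\<^sup>2 + 5 * s * Polynomial.degree f + 2 * Polynomial.degree f" (is "card ?Z \<le> _")
proof -
  interpret Q: frobenius "TYPE('k)" "q\<^sup>2" by (rule frobenius_power) simp
  define d where "d = Polynomial.degree f"
  have d: "d \<ge> 1"
  proof -
    have "g \<noteq> 0" using g by auto
    thus ?thesis using e by (auto simp: d_def f degree_mult_eq degree_power_eq)
  qed
  \<comment> \<open>Modulo \<open>q = 3 * s + 1\<close> the numbers \<open>e * E j\<close> below are
    0, s + 1, 2 s + 1 for \<open>e = 1\<close> and 0, s + 1, 2 s + 2 for \<open>e = 2\<close>. The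
    smallest cyclic gap is s - 1, and this is the room for \<open>l\<close>. \<open>B\<close> is
    chosen so that the \<open>3 * B * A\<close> unknowns outnumber the coefficients.\<close>
  define A where "A = s - 1"
  define B where "B = s + d"
  txt \<open>These exponents satisfy \<open>E j * q = j * (q\<^sup>2 - 1) / 3 + E' j\<close>, so that \<open>(f ^ E j) ^ q\<close> equals
    \<open>u ^ j * f ^ E' j\<close> where the cubic residue symbol of \<open>f\<close> is \<open>u\<close>; modulo \<open>q\<close> the numbers \<open>e * E j\<close>
    are roughly \<open>q / 3\<close> apart, which keeps the orders of vanishing at 0 of the terms of \<open>H\<close> distinct.\<close>
  define E where "E j = (if j = 0 then 0 else j * s + 1)" for j :: nat
  define E' where "E' j = (if j = 0 then 0 else (3 - j) * s + 1)" for j :: nat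
  define I where "I = {..<3::nat} \<times> {..<B} \<times> {..<A}"
  \<comment> \<open>On the set to be counted, \<open>T (j, i, l)\<close> takes the values of the
    \<open>q\<close>-th power of X^(l + q i) f^(E j), but with the exponent q l + q^2 i of X lowered
    to q l + i.\<close>
  define T where "T = (\<lambda>(j, i, l). Polynomial.smult (u ^ j) (Polynomial.monom 1 (q * l + i) * f ^ E' j))"
  define \<Phi> where "\<Phi> \<alpha> = (\<Sum>x\<in>I. Polynomial.smult (\<alpha> x ^ q) (T x))" for \<alpha>
  define D where "D = q * (A - 1) + (B - 1) + d * (2 * s + 1) + 1"
  define PP where "PP = {p. p \<in> Q.fixed_poly \<and> (\<forall>i\<ge>D. poly.coeff p i = 0)}"
  have fin_I [simp]: "finite I" by (simp add: I_def)
  have E_le: "E j \<le> 2 * s + 1" "E' j \<le> 2 * s + 1" if "j < 3" for j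
    using that by (auto simp: E_def E'_def less_Suc_eq numeral_3_eq_3)
  have deg_fE: "Polynomial.degree (f ^ n) \<le> d * (2 * s + 1)" if "n \<le> 2 * s + 1" for n
    using degree_power_le[of f n] mult_le_mono2[OF that, of d] by (simp add: d_def)
  have u_fixed: "u \<in> Q.fixed"
  proof -
    have "q\<^sup>2 = 3 * (3 * s\<^sup>2 + 2 * s) + 1" by (simp add: q power2_eq_square algebra_simps)
    hence "u ^ (q\<^sup>2) = (u ^ 3) ^ (3 * s\<^sup>2 + 2 * s) * u" by (simp add: power_add power_mult)
    thus ?thesis using u by (simp add: Q.fixed_def)
  qed
  have f_poly: "f \<in> Q.fixed_poly" using f_fixed by (simp add: Q.fixed_poly_def Q.fixed_def)

  have card_PP: "card PP \<le> (q\<^sup>2) ^ D \<and> finite PP"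
    unfolding PP_def using Q.card_fixed_poly_bounded_degree[of D] by blast
  have \<Phi>_PP: "\<Phi> \<alpha> \<in> PP" if "\<alpha> \<in> (\<Pi>\<^sub>E x\<in>I. Q.fixed)" for \<alpha>
  proof -
    have "\<Phi> \<alpha> \<in> Q.fixed_poly"
      unfolding \<Phi>_def T_def
      using PiE_mem[OF that] u_fixed f_poly
      by (auto intro!: Q.fixed_poly_sum Q.fixed_poly_smult Q.fixed_poly_mult Q.fixed_poly_power)
    moreover have "Polynomial.degree (\<Phi> \<alpha>) \<le> D - 1"
      unfolding \<Phi>_def
    proof (rule degree_sum_le)
      fix x assume x: "x \<in> I"
      obtain j i l where jil: "x = (j, i, l)" by (cases x)
      have "Polynomial.degree (Polynomial.smult (\<alpha> x ^ q) (T x)) \<le> (q * l + i) + d * (2 * s + 1)"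
        unfolding jil T_def split
        using x deg_fE[OF E_le(2)[of j]]
        by (intro order.trans[OF degree_smult_le] order.trans[OF degree_mult_le] add_mono degree_monom_le)
           (auto simp: I_def jil)
      also have "\<dots> \<le> D - 1"
      proof -
        have "q * l \<le> q * (A - 1)" using x by (intro mult_le_mono2) (auto simp: I_def jil)
        moreover have "i \<le> B - 1" using x by (auto simp: I_def jil)
        ultimately show ?thesis unfolding D_def by linarith
      qed
      finally show "Polynomial.degree (Polynomial.smult (\<alpha> x ^ q) (T x)) \<le> D - 1" .
    qed simp
    ultimately show ?thesis by (auto simp: PP_def D_def intro!: coeff_eq_0)
  qed
  \<comment> \<open>More unknowns than coefficients: the difference is s + 2 + d (s - 5),
    nonnegative in its last term because \<open>s\<close> is at least 5.\<close>
  have "D < 3 * (B * A)"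
  proof -
    obtain t where t: "s = t + 5" using s le_Suc_ex[of 5 s] by (auto simp: add.commute)
    obtain d' where d': "d = d' + 1" using d le_Suc_ex[of 1 d] by (auto simp: add.commute)
    show ?thesis unfolding D_def A_def B_def q t d' by (simp add: algebra_simps)
  qed
  hence "(q\<^sup>2) ^ D < (q\<^sup>2) ^ (3 * (B * A))"
    using one_less_power[OF q_gt_1, of 2] by (intro power_strict_increasing) auto
  also have "\<dots> = card (\<Pi>\<^sub>E x\<in>I. Q.fixed)"
    by (simp add: card_PiE Q.card_fixed) (simp add: I_def)
  finally have "card PP < card (\<Pi>\<^sub>E x\<in>I. Q.fixed)" using card_PP by linarith
  \<comment> \<open>Pigeonhole in place of linear algebra: \<Phi> is additive because the
    \<open>q\<close>-th power is, so two coefficient families with the same image differ by a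
    nonzero family in the kernel.\<close>
  moreover have "card (\<Phi> ` (\<Pi>\<^sub>E x\<in>I. Q.fixed)) \<le> card PP"
    using \<Phi>_PP card_PP by (intro card_mono) auto
  ultimately have "\<not> inj_on \<Phi> (\<Pi>\<^sub>E x\<in>I. Q.fixed)" by (intro pigeonhole) linarith
  then obtain \<alpha> \<beta> where \<alpha>: "\<alpha> \<in> (\<Pi>\<^sub>E x\<in>I. Q.fixed)" and \<beta>: "\<beta> \<in> (\<Pi>\<^sub>E x\<in>I. Q.fixed)"
    and ne: "\<alpha> \<noteq> \<beta>" and eq: "\<Phi> \<alpha> = \<Phi> \<beta>"
    unfolding inj_on_def by blast
  define \<delta> where "\<delta> x = \<alpha> x - \<beta> x" for x
  have \<Phi>\<delta>: "\<Phi> \<delta> = 0"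
    using eq by (simp add: \<Phi>_def \<delta>_def frob_diff smult_diff_left sum_subtractf)
  obtain x1 where x1: "x1 \<in> I" "\<delta> x1 \<noteq> 0"
    using PiE_ext[OF \<alpha> \<beta>] ne by (auto simp: \<delta>_def)

  \<comment> \<open>The coefficients of \<open>H\<close> are the \<open>q\<close>-th roots of those
    in \<open>\<Phi> \<delta>\<close>. On the counted set the \<open>q\<close>-th power of
    \<open>H\<close> therefore agrees with \<open>\<Phi> \<delta> = 0\<close>, which makes every
    counted point a root.\<close>
  define H where "H = (\<Sum>x\<in>I. case x of (j, i, l) \<Rightarrow>
      Polynomial.smult (\<delta> x) (Polynomial.monom 1 (l + q * i) * f ^ E j))"
  have H_root: "poly H x = 0" if x: "x \<in> ?Z" for x
  proof -
    from x have xQ: "x ^ (q\<^sup>2) = x" and fx: "poly f x ^ ((q\<^sup>2 - 1) div 3) = u" by auto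
    have M: "(q\<^sup>2 - 1) div 3 = 3 * s\<^sup>2 + 2 * s"
      by (simp add: q power2_eq_square algebra_simps)
    have "poly H x ^ q = (\<Sum>y\<in>I. (case y of (j, i, l) \<Rightarrow> \<delta> y * (x ^ (l + q * i) * poly f x ^ E j)) ^ q)"
      unfolding H_def poly_sum frob_sum
      by (intro sum.cong) (auto simp: poly_monom)
    also have "\<dots> = (\<Sum>y\<in>I. \<delta> y ^ q * poly (T y) x)"
    proof (rule sum.cong)
      fix y assume y: "y \<in> I"
      obtain j i l where jil: "y = (j, i, l)" by (cases y)
      have j: "j = 0 \<or> j = 1 \<or> j = 2" using y by (auto simp: I_def jil)
      have "(x ^ (l + q * i)) ^ q = x ^ (q * l + q\<^sup>2 * i)"
        by (simp add: algebra_simps power2_eq_square flip: power_mult)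
      also have "\<dots> = x ^ (q * l + i)" by (simp add: power_add power_mult xQ)
      finally have 1: "(x ^ (l + q * i)) ^ q = x ^ (q * l + i)" .
      have "E j * q = (3 * s\<^sup>2 + 2 * s) * j + E' j"
        using j by (auto simp: E_def E'_def q algebra_simps power2_eq_square)
      hence "(poly f x ^ E j) ^ q = poly f x ^ ((3 * s\<^sup>2 + 2 * s) * j + E' j)"
        by (simp flip: power_mult)
      also have "\<dots> = u ^ j * poly f x ^ E' j"
        using fx M by (simp add: power_add power_mult)
      finally have 2: "(poly f x ^ E j) ^ q = u ^ j * poly f x ^ E' j" .
      show "(case y of (j, i, l) \<Rightarrow> \<delta> y * (x ^ (l + q * i) * poly f x ^ E j)) ^ q = \<delta> y ^ q * poly (T y) x"
        unfolding jil T_def split by (simp add: power_mult_distrib 1 2 poly_monom)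
    qed simp
    also have "\<dots> = poly (\<Phi> \<delta>) x" by (simp add: \<Phi>_def poly_sum)
    finally show ?thesis using \<Phi>\<delta> q_gt_1 by simp
  qed

  \<comment> \<open>The order of vanishing at 0 of X^(l + q i) f^(E j), since \<open>f\<close> is
    X^e times \<open>g\<close> and \<open>g\<close> does not vanish at 0.\<close>
  define v where "v = (\<lambda>(j, i, l). l + q * i + e * E j)"
  have v_inj: "x = y" if xy: "x \<in> I" "y \<in> I" "v x = v y" for x y
  proof -
    obtain j i l where jil: "x = (j, i, l)" by (cases x)
    obtain j' i' l' where jil': "y = (j', i', l')" by (cases y)
    have j: "j = 0 \<or> j = 1 \<or> j = 2" and j': "j' = 0 \<or> j' = 1 \<or> j' = 2"
      using xy by (auto simp: I_def jil jil')
    have l: "l < s - 1" and l': "l' < s - 1"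
      using xy by (auto simp: I_def jil jil' A_def)
    have eq: "q * i + (l + e * E j) = q * i' + (l' + e * E j')"
      using xy by (simp add: v_def jil jil')
    have "l + e * E j < 2 * q" "l' + e * E j' < 2 * q"
      using e j j' l l' by (auto simp: E_def q)
    from residue_cases[OF eq this] have jl: "j = j' \<and> l = l'"
      using e j j' l l' s by (elim disjE) (simp_all add: E_def q)
    with eq q_gt_1 have "i = i'" by simp
    with jl show ?thesis by (simp add: jil jil')
  qed
  have "H \<noteq> 0"
  proof -
    define v0 where "v0 = Min (v ` {x\<in>I. \<delta> x \<noteq> 0})"
    have "v0 \<in> v ` {x\<in>I. \<delta> x \<noteq> 0}"
      unfolding v0_def using x1 by (intro Min_in) (simp, blast)
    then obtain x0 where x0: "x0 \<in> I" "\<delta> x0 \<noteq> 0" "v x0 = v0" by auto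
    have min: "v0 \<le> v x" if "x \<in> I" "\<delta> x \<noteq> 0" for x
      unfolding v0_def using that by (intro Min_le) auto
    \<comment> \<open>The orders are distinct, so only the term of least order reaches this
      coefficient.\<close>
    have "poly.coeff H v0 = (\<Sum>x\<in>I. if x = x0 then \<delta> x * poly g 0 ^ E (fst x) else 0)"
      unfolding H_def coeff_sum
    proof (rule sum.cong)
      fix x assume x: "x \<in> I"
      obtain j i l where jil: "x = (j, i, l)" by (cases x)
      have "Polynomial.monom 1 (l + q * i) * f ^ E j = Polynomial.monom 1 (v x) * g ^ E j"
        by (simp add: f v_def jil power_mult_distrib mult_monom monom_altdef power_add power_mult mult_ac)
      hence "poly.coeff (Polynomial.smult (\<delta> x) (Polynomial.monom 1 (l + q * i) * f ^ E j)) v0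
           = \<delta> x * (if v0 < v x then 0 else poly.coeff (g ^ E j) (v0 - v x))"
        by (simp add: coeff_monom_mult)
      also have "\<dots> = (if x = x0 then \<delta> x * poly g 0 ^ E (fst x) else 0)"
      proof (cases "x = x0 \<or> \<delta> x = 0")
        case True
        thus ?thesis using x0 by (auto simp: jil poly_power simp flip: poly_0_coeff_0)
      next
        case False
        hence "v0 < v x" using min[OF x] v_inj[OF x x0(1)] x0(3) by fastforce
        thus ?thesis using False by simp
      qed
      finally show "poly.coeff (case x of (j, i, l) \<Rightarrow>
          Polynomial.smult (\<delta> x) (Polynomial.monom 1 (l + q * i) * f ^ E j)) v0 =
          (if x = x0 then \<delta> x * poly g 0 ^ E (fst x) else 0)"
        by (simp add: jil)
    qed simp
    also have "\<dots> \<noteq> 0" using x0 g by (simp add: sum.delta)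
    finally show ?thesis by auto
  qed
  have "card ?Z \<le> card {x. poly H x = 0}"
    using H_root poly_roots_finite[OF \<open>H \<noteq> 0\<close>] by (intro card_mono) auto
  also have "\<dots> \<le> Polynomial.degree H" by (rule card_poly_roots_bound) fact
  also have "\<dots> \<le> (A - 1) + q * (B - 1) + d * (2 * s + 1)"
    unfolding H_def
  proof (rule degree_sum_le)
    fix x assume x: "x \<in> I"
    obtain j i l where jil: "x = (j, i, l)" by (cases x)
    have "Polynomial.degree (Polynomial.smult (\<delta> x) (Polynomial.monom 1 (l + q * i) * f ^ E j))
            \<le> (l + q * i) + d * (2 * s + 1)"
      using x deg_fE[OF E_le(1)[of j]]
      by (intro order.trans[OF degree_smult_le] order.trans[OF degree_mult_le] add_mono degree_monom_le)
         (auto simp: I_def jil)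
    also have "\<dots> \<le> (A - 1) + q * (B - 1) + d * (2 * s + 1)"
      using x by (intro add_mono mult_le_mono2) (auto simp: I_def jil)
    finally show "Polynomial.degree (case x of (j, i, l) \<Rightarrow>
        Polynomial.smult (\<delta> x) (Polynomial.monom 1 (l + q * i) * f ^ E j)) \<le> \<dots>"
      by (simp add: jil)
  qed simp
  also have "\<dots> \<le> 3 * s\<^sup>2 + 5 * s * d + 2 * d"
  proof -
    obtain t where t: "s = t + 5" using s le_Suc_ex[of 5 s] by (auto simp: add.commute)
    obtain d' where d': "d = d' + 1" using d le_Suc_ex[of 1 d] by (auto simp: add.commute)
    show ?thesis unfolding A_def B_def q t d' by (simp add: algebra_simps power2_eq_square)
  qed
  finally show ?thesis by (simp add: d_def)
qed

end

section \<open>Cubic character sums of products of linear factors over the extensions\<close>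

locale cubic_character_sum = cubic_frobenius K q w
  for K :: "'k::alg_closed_field itself" and q and w :: 'k +
  fixes C :: "'k set" and e :: "'k \<Rightarrow> nat"
  assumes C_fixed: "C \<subseteq> fixed" and C_ne: "C \<noteq> {}"
    and e: "\<And>c. c \<in> C \<Longrightarrow> e c = 1 \<or> e c = 2"
    and q_ge: "q \<ge> 16"
begin

lemma finite_C [simp]: "finite C"
  using C_fixed finite_fixed by (rule finite_subset)

definition shift_prod :: "'k \<Rightarrow> 'k" where
  "shift_prod x = (\<Prod>c\<in>C. (c - x) ^ e c)"

text \<open>The exponent gives the cubic character of the field with \<open>q ^ k\<close> elements,
  which is \<open>cubic_char\<close> of the norm down to \<open>fixed\<close>.\<close>

definition ext_sum :: "nat \<Rightarrow> complex" where
  "ext_sum k = (\<Sum>x | x ^ (q ^ k) = x. chi (shift_prod x ^ ((q ^ k - 1) div 3)))"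

text \<open>Each of the three classes has at most \<open>T\<close> elements, about a third of the
  field, and together with at most \<open>card C\<close> zeros they fill it. So none can be much
  smaller than a third either, and the sum weighted by cube roots of unity almost cancels.\<close>

lemma ext_sum_bound: "\<exists>B. \<forall>k\<ge>1. norm (ext_sum (2 * k)) \<le> B * real q ^ k"
proof -
  obtain c0 where c0: "c0 \<in> C" using C_ne by auto
  \<comment> \<open>The shift by \<open>c0\<close> moves a root to 0, where \<open>stepanov\<close>
    expects the factor \<open>[:0, 1:] ^ e\<close>.\<close>
  define f where "f = (\<Prod>c\<in>C. [:c - c0, -1:] ^ e c)"
  define g where "g = Polynomial.smult ((-1) ^ e c0) (\<Prod>c\<in>C - {c0}. [:c - c0, -1:] ^ e c)"
  have fg: "f = [:0, 1:] ^ e c0 * g"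
  proof -
    have "[:0, -1:] = Polynomial.smult (-1) [:0, 1 :: 'k:]" by simp
    hence "[:0, -1:] ^ e c0 = Polynomial.smult ((-1) ^ e c0) ([:0, 1 :: 'k:] ^ e c0)"
      by (simp only: smult_power)
    thus ?thesis using c0 by (simp add: f_def g_def prod.remove[of C c0])
  qed
  have g0: "poly g 0 \<noteq> 0" by (simp add: g_def poly_prod)
  have f_fixed: "f \<in> fixed_poly" unfolding f_def
    using C_fixed c0 by (intro fixed_poly_prod fixed_poly_power fixed_poly_linear) (auto intro!: fixed_diff)
  have poly_f: "poly f x = shift_prod (x + c0)" for x
    by (simp add: f_def shift_prod_def poly_prod algebra_simps)
  define d where "d = Polynomial.degree f"
  have "norm (ext_sum (2 * k)) \<le> (11 * real d + real (card C)) * real q ^ k" if k: "k \<ge> 1" for k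
  proof -
    interpret R: cubic_frobenius "TYPE('k)" "q ^ k" w by (rule cubic_frobenius_power) (use k in auto)
    define Q where "Q = (q ^ k)\<^sup>2"
    have Q': "q ^ (2 * k) = Q" by (simp add: Q_def power_mult mult.commute)
    interpret Q: cubic_frobenius "TYPE('k)" Q w
      unfolding Q'[symmetric] by (rule cubic_frobenius_power) (use k in auto)
    define s where "s = q ^ k div 3"
    have s: "q ^ k = 3 * s + 1" using R.q_mod_3 by (simp add: s_def) presburger
    have "q ^ 1 \<le> q ^ k" using k q_gt_1 by (intro power_increasing) auto
    hence s5: "s \<ge> 5" using q_ge s by simp
    define T where "T = 3 * s\<^sup>2 + 5 * s * d + 2 * d"
    define M where "M = (Q - 1) div 3"
    define Z where "Z u = {x \<in> Q.fixed. shift_prod x ^ M = u}" for u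
    have fin: "finite (Z u)" for u by (simp add: Z_def)
    have Z_le: "card (Z u) \<le> T" if u: "u ^ 3 = 1" for u
    proof -
      have eq: "card (Z u) = card ((\<lambda>x. x - c0) ` Z u)" by (simp add: card_image)
      have sub: "(\<lambda>x. x - c0) ` Z u \<subseteq> {x. x ^ ((q ^ k)\<^sup>2) = x \<and> poly f x ^ (((q ^ k)\<^sup>2 - 1) div 3) = u}"
      proof safe
        fix x assume x: "x \<in> Z u"
        have "c0 \<in> Q.fixed" using c0 C_fixed fixed_power_q[of c0 "2 * k"] Q'
          by (auto simp: Q.fixed_def)
        with x have "x - c0 \<in> Q.fixed" by (auto simp: Z_def)
        hence "(x - c0) ^ Q = x - c0" by (simp add: Q.fixed_def)
        thus "(x - c0) ^ ((q ^ k)\<^sup>2) = x - c0" by (simp only: Q_def)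
        show "poly f (x - c0) ^ (((q ^ k)\<^sup>2 - 1) div 3) = u"
          using x by (simp add: poly_f Z_def M_def Q_def)
      qed
      have "{x. x ^ ((q ^ k)\<^sup>2) = x \<and> poly f x ^ (((q ^ k)\<^sup>2 - 1) div 3) = u} \<subseteq> Q.fixed"
        unfolding Q.fixed_def by (simp only: Q_def) blast
      hence "finite {x. x ^ ((q ^ k)\<^sup>2) = x \<and> poly f x ^ (((q ^ k)\<^sup>2 - 1) div 3) = u}"
        using Q.finite_fixed by (rule finite_subset)
      hence "card (Z u) \<le> card {x. x ^ ((q ^ k)\<^sup>2) = x \<and> poly f x ^ (((q ^ k)\<^sup>2 - 1) div 3) = u}"
        unfolding eq using sub by (rule card_mono)
      also have "\<dots> \<le> T"
        unfolding T_def d_def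
      proof (rule R.stepanov[OF s s5 fg g0 e[OF c0] _ u])
        fix i
        have "poly.coeff f i \<in> fixed" using f_fixed by (simp add: fixed_poly_def)
        from fixed_power_q[OF this, of "2 * k"]
        show "poly.coeff f i ^ (q ^ k)\<^sup>2 = poly.coeff f i" by (simp add: Q' Q_def)
      qed
      finally show ?thesis .
    qed
    have shift_prod_Q: "shift_prod x \<in> Q.fixed" if "x \<in> Q.fixed" for x
      unfolding shift_prod_def
    proof (intro Q.fixed_prod Q.fixed_power Q.fixed_diff that)
      fix c assume "c \<in> C"
      thus "c \<in> Q.fixed" using C_fixed fixed_power_q[of c "2 * k"] Q' by (auto simp: Q.fixed_def)
    qed
    have Q_fixed: "Q.fixed = {x. x ^ (q ^ (2 * k)) = x}" by (simp add: Q.fixed_def Q')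
    have part: "Q.fixed = Z 0 \<union> (Z 1 \<union> (Z w \<union> Z (w\<^sup>2)))"
      using Q.fixed_power_third[OF shift_prod_Q] cube_root_cases by (auto simp: Z_def M_def)
    have w2_cube: "(w\<^sup>2) ^ 3 = 1"
      by (metis w_cube power_one power_mult mult.commute)
    have disj: "Z u \<inter> Z v = {}" if "u \<noteq> v" for u v using that by (auto simp: Z_def)
    have disjs: "Z 0 \<inter> (Z 1 \<union> (Z w \<union> Z (w\<^sup>2))) = {}" "Z 1 \<inter> (Z w \<union> Z (w\<^sup>2)) = {}" "Z w \<inter> Z (w\<^sup>2) = {}"
      by (simp_all add: Int_Un_distrib disj w_ne w_ne[symmetric])
    have Q_card: "Q = card (Z 0) + (card (Z 1) + (card (Z w) + card (Z (w\<^sup>2))))"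
      using Q.card_fixed part disjs fin by (simp add: card_Un_disjoint)
    have "Z 0 \<subseteq> C" by (auto simp: Z_def shift_prod_def)
    hence Z0: "card (Z 0) \<le> card C" by (intro card_mono) auto
    let ?z = "cis (2 * pi / 3)"
    define n0 n1 n2 where n: "n0 = real (card (Z 1))" "n1 = real (card (Z w))" "n2 = real (card (Z (w\<^sup>2)))"
    have const: "(\<Sum>x\<in>Z u. chi (shift_prod x ^ M)) = of_nat (card (Z u)) * chi u" for u
      by (simp add: Z_def)
    have "ext_sum (2 * k) = (\<Sum>x\<in>Q.fixed. chi (shift_prod x ^ M))"
      by (simp add: ext_sum_def Q_fixed M_def Q')
    also have "\<dots> = of_real n0 + of_real n1 * ?z + of_real n2 * ?z\<^sup>2"
      unfolding part using disjs fin
      by (simp add: sum.union_disjoint const n chi_w chi_w2)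
    \<comment> \<open>A multiple of the vanishing sum of the cube roots of unity turns the counts
      into nonnegative deficits, whose total is \<open>3 * T + card (Z 0) - Q\<close>.\<close>
    also have "\<dots> = - (of_real (T - n0) + of_real (T - n1) * ?z + of_real (T - n2) * ?z\<^sup>2) + of_nat T * (1 + ?z + ?z\<^sup>2)"
      by (simp add: algebra_simps)
    also have "\<dots> = - (of_real (T - n0) + of_real (T - n1) * ?z + of_real (T - n2) * ?z\<^sup>2)"
      by (simp add: sum_cube_roots)
    finally have "norm (ext_sum (2 * k)) = norm (of_real (T - n0) + of_real (T - n1) * ?z + of_real (T - n2) * ?z\<^sup>2)"
      by (simp only: norm_minus_cancel)
    also have "\<dots> \<le> norm (of_real (T - n0) :: complex) + norm (of_real (T - n1) * ?z) + norm (of_real (T - n2) * ?z\<^sup>2)"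
      by (intro order.trans[OF norm_triangle_ineq] add_mono order.refl)
    also have "\<dots> = (T - n0) + (T - n1) + (T - n2)"
      using Z_le[of 1] Z_le[OF w_cube] Z_le[OF w2_cube]
      by (simp add: norm_mult norm_power n del: of_real_diff)
    also have "\<dots> = 3 * real T + real (card (Z 0)) - real Q"
      using arg_cong[OF Q_card, of real] by (simp add: n)
    also have "\<dots> \<le> 3 * real T + real (card C) - real Q" using Z0 by simp
    also have "\<dots> \<le> 15 * real s * real d + 6 * real d + real (card C)"
    proof -
      have "real Q = (3 * real s + 1)\<^sup>2" by (simp add: Q_def s)
      thus ?thesis by (simp add: T_def power2_eq_square algebra_simps)
    qed
    also have "\<dots> \<le> (11 * real d + real (card C)) * (3 * real s + 1)"
      by (simp add: algebra_simps)
    also have "\<dots> = (11 * real d + real (card C)) * real q ^ k"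
      using arg_cong[OF s, of real] by simp
    finally show ?thesis .
  qed
  thus ?thesis by blast
qed

end

section \<open>Newton's identity for the L-function\<close>

lemma dvd_iff_proots:
  fixes p r :: "'k::alg_closed_field poly"
  assumes "p \<noteq> 0" "r \<noteq> 0"
  shows "p dvd r \<longleftrightarrow> proots p \<subseteq># proots r"
proof
  assume "p dvd r"
  then obtain h where "r = p * h" by (auto simp: dvd_def)
  thus "proots p \<subseteq># proots r" using assms by (auto simp: proots_mult)
next
  assume "proots p \<subseteq># proots r"
  then obtain M where M: "proots r = proots p + M" by (auto simp: subset_mset.le_iff_add)
  have "r = Polynomial.smult (Polynomial.lead_coeff r) (\<Prod>x\<in>#proots r. [:-x, 1:])"
    by (rule poly_eq_prod_proots[OF assms(2)])
  also have "\<dots> = Polynomial.smult (Polynomial.lead_coeff r)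
      ((\<Prod>x\<in>#proots p. [:-x, 1:]) * (\<Prod>x\<in>#M. [:-x, 1:]))"
    by (simp only: M image_mset_union prod_mset.union)
  finally have "(\<Prod>x\<in>#proots p. [:-x, 1:]) dvd r"
    by (metis dvd_smult dvd_triv_left)
  thus "p dvd r"
    by (subst poly_eq_prod_proots[OF assms(1)]) (use assms in \<open>simp add: smult_dvd_iff\<close>)
qed

section \<open>Frobenius orbits and divisibility of polynomials over the fixed field\<close>

context frobenius
begin

definition frob_poly :: "'k poly \<Rightarrow> 'k poly" where
  "frob_poly = map_poly (\<lambda>x. x ^ q)"

lemma coeff_frob_poly: "poly.coeff (frob_poly p) i = poly.coeff p i ^ q"
  using q_gt_1 by (simp add: frob_poly_def coeff_map_poly)

lemma frob_poly_mult: "frob_poly (p * r) = frob_poly p * frob_poly r"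
  by (rule poly_eqI) (simp add: coeff_frob_poly coeff_mult frob_sum power_mult_distrib)

lemma frob_poly_1: "frob_poly 1 = 1"
  using q_gt_1 by (intro poly_eqI) (auto simp: coeff_frob_poly)

lemma frob_poly_prod: "frob_poly (\<Prod>i\<in>A. h i) = (\<Prod>i\<in>A. frob_poly (h i))"
  by (induction A rule: infinite_finite_induct) (auto simp: frob_poly_mult frob_poly_1)

lemma frob_poly_power: "frob_poly (p ^ n) = frob_poly p ^ n"
  by (induction n) (auto simp: frob_poly_mult frob_poly_1)

lemma frob_poly_linear: "frob_poly [:-x, 1:] = [:-(x ^ q), 1:]"
  using q_gt_1 frob_diff[of 0 x]
  by (intro poly_eqI) (auto simp: coeff_frob_poly coeff_pCons split: nat.splits)

lemma fixed_poly_iff: "p \<in> fixed_poly \<longleftrightarrow> frob_poly p = p"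
  by (auto simp: fixed_poly_def fixed_def poly_eq_iff coeff_frob_poly)

lemma fixed_poly_cancel:
  assumes "p * h \<in> fixed_poly" "p \<in> fixed_poly" "p \<noteq> 0"
  shows "h \<in> fixed_poly"
  using assms by (auto simp: fixed_poly_iff frob_poly_mult)

lemma frob_power_inj: "x ^ (q ^ i) = y ^ (q ^ i) \<Longrightarrow> x = (y :: 'k)"
  by (induction i) (auto simp: power_mult power_Suc2 simp del: power_Suc dest!: frob_inj)

definition monic_polys :: "nat \<Rightarrow> 'k poly set" where
  "monic_polys n = {g \<in> fixed_poly. Polynomial.lead_coeff g = 1 \<and> Polynomial.degree g = n}"

lemma monic_polys_nz: "g \<in> monic_polys n \<Longrightarrow> g \<noteq> 0"
  by (auto simp: monic_polys_def)

lemma finite_monic_polys [simp]: "finite (monic_polys n)"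
  by (rule finite_subset[OF _ card_fixed_poly_bounded_degree(1)[of "Suc n"]])
     (auto simp: monic_polys_def intro: coeff_eq_0)

lemma monic_polys_0: "monic_polys 0 = {1}"
  by (auto simp: monic_polys_def elim!: degree_eq_zeroE)

text \<open>For \<open>x\<close> in the degree \<open>k\<close> extension of \<^term>\<open>fixed\<close>, this is the characteristic polynomial of
  multiplication by \<open>x\<close>.\<close>

definition conj_poly :: "nat \<Rightarrow> 'k \<Rightarrow> 'k poly" where
  "conj_poly k x = (\<Prod>i<k. [:-(x ^ (q ^ i)), 1:])"

text \<open>Frobenius permutes the linear factors cyclically because \<open>x ^ (q ^ k) = x\<close>,
  so the coefficients are fixed.\<close>

lemma conj_poly_monic:
  assumes "x ^ (q ^ k) = x" "k \<ge> 1"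
  shows "conj_poly k x \<in> monic_polys k"
proof -
  obtain k' where k': "k = Suc k'" using assms(2) by (cases k) auto
  have "frob_poly (conj_poly k x) = (\<Prod>i<Suc k'. [:-(x ^ (q ^ Suc i)), 1:])"
    by (simp only: conj_poly_def frob_poly_prod frob_poly_linear k' power_Suc2 power_mult)
  also have "\<dots> = (\<Prod>i<k'. [:-(x ^ (q ^ Suc i)), 1:]) * [:-x, 1:]"
    using assms(1) by (simp only: prod.lessThan_Suc k')
  also have "\<dots> = conj_poly k x"
    by (simp add: conj_poly_def k' prod.lessThan_Suc_shift del: prod.lessThan_Suc)
  finally have "conj_poly k x \<in> fixed_poly" by (simp add: fixed_poly_iff)
  moreover have "Polynomial.degree (conj_poly k x) = k"
    by (simp add: conj_poly_def degree_prod_eq_sum_degree)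
  moreover have "Polynomial.lead_coeff (conj_poly k x) = 1"
    by (simp add: conj_poly_def lead_coeff_prod)
  ultimately show ?thesis by (simp add: monic_polys_def)
qed

lemma conj_poly_nz: "conj_poly k x \<noteq> 0"
  by (simp add: conj_poly_def)

lemma proots_conj_poly: "proots (conj_poly k x) = image_mset (\<lambda>i. x ^ (q ^ i)) (mset_set {..<k})"
proof -
  have "proots (conj_poly k x) = (\<Sum>i<k. {#x ^ (q ^ i)#})"
    unfolding conj_poly_def by (subst proots_prod) auto
  thus ?thesis by (simp add: sum_unfold_sum_mset)
qed

lemma bij_betw_monic_mult:
  assumes p: "p \<in> monic_polys k" and "k \<le> n"
  shows "bij_betw (\<lambda>h. p * h) (monic_polys (n - k)) {g \<in> monic_polys n. p dvd g}"
proof (rule bij_betwI')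
  show "p * h = p * h' \<longleftrightarrow> h = h'" for h h' using monic_polys_nz[OF p] by simp
  show "p * h \<in> {g \<in> monic_polys n. p dvd g}" if "h \<in> monic_polys (n - k)" for h
  proof -
    have "Polynomial.lead_coeff p = 1" "Polynomial.lead_coeff h = 1"
      using p that unfolding monic_polys_def by blast+
    hence "Polynomial.lead_coeff (p * h) = 1"
      by (simp only: lead_coeff_mult mult_1)
    moreover have "Polynomial.degree (p * h) = n"
      using p that \<open>k \<le> n\<close> monic_polys_nz[OF p] monic_polys_nz[OF that]
      by (simp add: monic_polys_def degree_mult_eq)
    ultimately show ?thesis using p that by (simp add: monic_polys_def fixed_poly_mult)
  qed
  fix g assume "g \<in> {g \<in> monic_polys n. p dvd g}"
  then obtain h where g: "g = p * h" "g \<in> monic_polys n" by (auto simp: dvd_def)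
  hence "h \<noteq> 0" using monic_polys_nz by fastforce
  have "h \<in> fixed_poly"
    using g p monic_polys_nz[OF p] fixed_poly_cancel by (auto simp: monic_polys_def)
  moreover have "Polynomial.lead_coeff h = 1"
    using g p lead_coeff_mult[of p h] by (auto simp: monic_polys_def)
  moreover have "Polynomial.degree h = n - k"
    using g p \<open>h \<noteq> 0\<close> monic_polys_nz[OF p] by (auto simp: monic_polys_def degree_mult_eq)
  ultimately show "\<exists>h\<in>monic_polys (n - k). g = p * h" using g by (auto simp: monic_polys_def)
qed

text \<open>Frobenius on coefficients fixes \<open>g\<close> and carries a factor (X - y)^v to (X -
  y^q)^v.\<close>

lemma order_frob_le:
  assumes "g \<in> fixed_poly" "g \<noteq> 0"
  shows "Polynomial.order x g \<le> Polynomial.order (x ^ (q ^ i)) g"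
proof (induction i)
  case (Suc i)
  let ?y = "x ^ (q ^ i)" and ?v = "Polynomial.order (x ^ (q ^ i)) g"
  obtain h where "g = [:-?y, 1:] ^ ?v * h" using order_1[of ?y g] by (auto simp: dvd_def)
  hence "frob_poly g = [:-(?y ^ q), 1:] ^ ?v * frob_poly h"
    by (metis frob_poly_linear frob_poly_mult frob_poly_power)
  hence "[:-(?y ^ q), 1:] ^ ?v dvd g"
    using assms by (metis dvd_triv_left fixed_poly_iff)
  hence "?v \<le> Polynomial.order (?y ^ q) g" using assms by (subst (asm) order_divides) auto
  thus ?case using Suc by (simp add: power_mult[symmetric] mult.commute)
qed simp

text \<open>If \<open>x\<close> has exact period \<open>d\<close> under Frobenius, the admissible
  \<open>k\<close> are the multiples \<open>d * t\<close>, and \<open>conj_poly (d * t) x\<close> is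
  the \<open>t\<close>-th power of the minimal polynomial of \<open>x\<close>. It divides
  \<open>g\<close> exactly when \<open>t\<close> is at most the order of \<open>x\<close>, because
  all conjugates have the same order. Roots are thus counted without factoring \<open>g\<close> into
  irreducibles.\<close>

lemma conj_poly_count:
  assumes g: "g \<in> fixed_poly" "g \<noteq> 0"
  shows "card {k. k \<ge> 1 \<and> x ^ (q ^ k) = x \<and> conj_poly k x dvd g} = Polynomial.order x g"
proof (cases "poly g x = 0")
  case False
  have "poly (conj_poly k x) x = 0" if "k \<ge> 1" for k
    using that by (auto simp: conj_poly_def poly_prod intro!: bexI[of _ 0])
  hence "{k. k \<ge> 1 \<and> x ^ (q ^ k) = x \<and> conj_poly k x dvd g} = {}"
    using False by (auto simp: dvd_def)
  thus ?thesis using False g by (metis card.empty order_root)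
next
  case True
  define per where "per k \<longleftrightarrow> x ^ (q ^ k) = x" for k
  have per_shift: "per k" if "x ^ (q ^ i) = x ^ (q ^ (i + k))" for i k
  proof -
    have "x ^ (q ^ i) = (x ^ (q ^ k)) ^ (q ^ i)"
      using that by (simp add: power_add power_mult[symmetric] mult.commute)
    thus ?thesis unfolding per_def using frob_power_inj by metis
  qed
  \<comment> \<open>The orbit of \<open>x\<close> consists of roots of \<open>g\<close>, so it is
    finite; injectivity of Frobenius turns a repetition into a return to \<open>x\<close>
    itself.\<close>
  have "\<exists>k\<ge>1. per k"
  proof -
    have "poly g (x ^ (q ^ i)) = 0" for i
      using order_frob_le[OF g, of x i] True g by (metis le_zero_eq order_root)
    hence "range (\<lambda>i. x ^ (q ^ i)) \<subseteq> {y. poly g y = 0}" by auto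
    hence "finite (range (\<lambda>i. x ^ (q ^ i)))"
      using poly_roots_finite[OF g(2)] finite_subset by blast
    hence "\<not> inj (\<lambda>i::nat. x ^ (q ^ i))" using finite_imageD by blast
    then obtain i j where "x ^ (q ^ i) = x ^ (q ^ j)" "i < j"
      unfolding inj_def by (metis linorder_neqE_nat)
    hence "per (j - i)" using per_shift[of i "j - i"] by simp
    thus ?thesis using \<open>i < j\<close> by (intro exI[of _ "j - i"]) auto
  qed
  define d where "d = (LEAST k. k \<ge> 1 \<and> per k)"
  have d: "d \<ge> 1" "per d" using LeastI_ex[OF \<open>\<exists>k\<ge>1. per k\<close>[unfolded Bex_def]] by (auto simp: d_def)
  have d_least: "d \<le> k" if "k \<ge> 1" "per k" for k
    unfolding d_def using that by (intro Least_le) auto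
  have per_mult: "x ^ (q ^ (d * t)) = x" for t
    using d(2) by (induction t) (auto simp: per_def power_add power_mult)
  have per_iff: "per k \<longleftrightarrow> d dvd k" for k
  proof
    assume "per k"
    have "x ^ (q ^ (d * (k div d) + k mod d)) = (x ^ (q ^ (d * (k div d)))) ^ (q ^ (k mod d))"
      by (simp only: power_add power_mult)
    hence "per (k mod d)" using \<open>per k\<close> per_mult by (simp add: per_def)
    moreover have "k mod d < d" using d by simp
    ultimately have "\<not> 1 \<le> k mod d" using d_least[of "k mod d"] by linarith
    thus "d dvd k" by (simp add: dvd_eq_mod_eq_0)
  qed (use per_mult in \<open>auto simp: per_def dvd_def\<close>)
  let ?o = "\<lambda>i. x ^ (q ^ i)"
  have inj: "inj_on ?o {..<d}"
  proof -
    have "i = j" if "i \<le> j" "j < d" "?o i = ?o j" for i j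
    proof (rule ccontr)
      assume "i \<noteq> j"
      moreover from this have "per (j - i)" using per_shift[of i "j - i"] that by simp
      ultimately have "d \<le> j - i" using that by (intro d_least) linarith+
      thus False using that \<open>i \<noteq> j\<close> by linarith
    qed
    thus ?thesis by (intro inj_onI) (metis lessThan_iff nle_le)
  qed
  have conj_mult: "conj_poly (d * t) x = conj_poly d x ^ t" for t
  proof (induction t)
    case (Suc t)
    have split: "prod h {..<m + n} = prod h {..<m} * (\<Prod>i<n. h (m + i))" for h :: "nat \<Rightarrow> 'k poly" and m n
      by (induction n) (simp_all add: mult.assoc)
    have "conj_poly (d * t + d) x = conj_poly (d * t) x * (\<Prod>i<d. [:-((x ^ (q ^ (d * t))) ^ (q ^ i)), 1:])"
      unfolding conj_poly_def by (subst split) (simp only: power_add power_mult)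
    thus ?case using Suc per_mult[of t] by (simp add: conj_poly_def add.commute mult.commute)
  qed (simp add: conj_poly_def)
  have dvd_iff: "conj_poly (d * t) x dvd g \<longleftrightarrow> t \<le> Polynomial.order x g" for t
  proof -
    have "conj_poly (d * t) x dvd g \<longleftrightarrow> repeat_mset t (mset_set (?o ` {..<d})) \<subseteq># proots g"
      using g conj_poly_nz
      by (subst dvd_iff_proots) (auto simp: conj_mult proots_power proots_conj_poly image_mset_mset_set inj)
    also have "\<dots> \<longleftrightarrow> (\<forall>i<d. t \<le> Polynomial.order (?o i) g)"
      using g by (auto simp: subseteq_mset_def count_mset_set')
    also have "\<dots> \<longleftrightarrow> t \<le> Polynomial.order x g"
      using order_frob_le[OF g, of x] d(1) by (auto intro: order.trans dest: spec[of _ 0])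
    finally show ?thesis .
  qed
  have "{k. k \<ge> 1 \<and> x ^ (q ^ k) = x \<and> conj_poly k x dvd g} =
        {k. k \<ge> 1 \<and> d dvd k \<and> conj_poly k x dvd g}"
    by (simp only: per_iff[unfolded per_def])
  also have "\<dots> = (\<lambda>t. d * t) ` {1..Polynomial.order x g}" (is "?A = ?B")
  proof (intro subset_antisym subsetI)
    fix k assume k: "k \<in> ?A"
    then obtain t where t: "k = d * t" by (auto elim: dvdE)
    hence "t \<in> {1..Polynomial.order x g}" using k dvd_iff[of t] by auto
    thus "k \<in> ?B" using t by blast
  next
    fix k assume "k \<in> ?B"
    then obtain t where t: "k = d * t" "1 \<le> t" "t \<le> Polynomial.order x g" by force
    thus "k \<in> ?A" using d(1) dvd_iff[of t] by simp
  qed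
  also have "card \<dots> = Polynomial.order x g" using d(1) by (subst card_image) (auto simp: inj_on_def)
  finally show ?thesis .
qed

end

context frobenius
begin

text \<open>For each root \<open>x\<close> the number of \<open>k\<close> is its multiplicity, and
  multiplicities add up to the degree. This plays the part of the von Mangoldt identity and produces
  the factor \<open>n\<close> in Newton's identity.\<close>

lemma conj_poly_total_count:
  assumes g: "g \<in> monic_polys n"
  shows "card {(k, x). k \<in> {1..n} \<and> x ^ (q ^ k) = x \<and> conj_poly k x dvd g} = n"
proof -
  have nz: "g \<noteq> 0" and fx: "g \<in> fixed_poly" and deg: "Polynomial.degree g = n"
    using g monic_polys_nz by (auto simp: monic_polys_def)
  define N where "N x = {k. k \<ge> 1 \<and> x ^ (q ^ k) = x \<and> conj_poly k x dvd g}" for x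
  let ?R = "{x. poly g x = 0}"
  have k_le: "k \<le> n \<and> poly g x = 0" if "k \<in> N x" for k x
  proof -
    have k: "k \<ge> 1" "x ^ (q ^ k) = x" "conj_poly k x dvd g" using that by (auto simp: N_def)
    have "Polynomial.degree (conj_poly k x) \<le> Polynomial.degree g"
      using k(3) nz by (rule dvd_imp_degree_le)
    moreover have "Polynomial.degree (conj_poly k x) = k"
      using conj_poly_monic[OF k(2,1)] by (simp add: monic_polys_def)
    moreover have "poly (conj_poly k x) x = 0"
      using k(1) by (auto simp: conj_poly_def poly_prod intro!: bexI[of _ 0])
    ultimately show ?thesis using k(3) deg by (auto simp: dvd_def)
  qed
  have fin: "finite (N x)" for x
    by (rule finite_subset[of _ "{..n}"]) (use k_le in auto)
  have "{(k, x). k \<in> {1..n} \<and> x ^ (q ^ k) = x \<and> conj_poly k x dvd g} = prod.swap ` (SIGMA x:?R. N x)"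
    using k_le by (force simp: N_def image_iff)
  also have "card \<dots> = card (SIGMA x:?R. N x)" by (rule card_image) simp
  also have "\<dots> = (\<Sum>x\<in>?R. card (N x))"
    using fin poly_roots_finite[OF nz] by simp
  also have "\<dots> = (\<Sum>x\<in>?R. Polynomial.order x g)"
    unfolding N_def by (intro sum.cong conj_poly_count fx nz refl)
  also have "\<dots> = size (proots g)"
    using nz by (simp add: size_multiset_overloaded_eq)
  finally show ?thesis using size_proots[OF nz] deg by simp
qed

end

section \<open>The L-function and the Weil bound\<close>

context cubic_character_sum
begin

text \<open>The resultant of \<open>g\<close> with the product of the
  \<open>[:-c, 1:] ^ e c\<close>; this makes \<open>L_char\<close> completely multiplicative on
  \<open>fixed_poly\<close>.\<close>

definition resultant_power :: "'k poly \<Rightarrow> 'k" where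
  "resultant_power g = (\<Prod>c\<in>C. poly g c ^ e c)"

definition L_char :: "'k poly \<Rightarrow> complex" where
  "L_char g = cubic_char (resultant_power g)"

definition L_coeff :: "nat \<Rightarrow> complex" where
  "L_coeff n = (\<Sum>g\<in>monic_polys n. L_char g)"

lemma resultant_power_fixed: "g \<in> fixed_poly \<Longrightarrow> resultant_power g \<in> fixed"
  unfolding resultant_power_def using C_fixed
  by (intro fixed_prod fixed_power poly_fixed) auto

lemma L_char_mult: "g \<in> fixed_poly \<Longrightarrow> h \<in> fixed_poly \<Longrightarrow> L_char (g * h) = L_char g * L_char h"
proof -
  assume g: "g \<in> fixed_poly" and h: "h \<in> fixed_poly"
  have "resultant_power (g * h) = resultant_power g * resultant_power h"
    by (simp add: resultant_power_def power_mult_distrib prod.distrib)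
  thus ?thesis using g h by (simp add: L_char_def cubic_char_mult resultant_power_fixed)
qed

lemma L_coeff_0: "L_coeff 0 = 1"
  by (simp add: L_coeff_def monic_polys_0 L_char_def resultant_power_def)

text \<open>The value of \<open>conj_poly k x\<close> at \<open>c\<close> is the norm of
  \<open>c - x\<close>, that is, \<open>c - x\<close> to the power 1 + q + ... + q^(k-1). Times
  \<open>(q - 1) div 3\<close> this exponent is \<open>(q ^ k - 1) div 3\<close>.\<close>

lemma L_char_conj_poly:
  assumes "x ^ (q ^ k) = x"
  shows "L_char (conj_poly k x) = chi (shift_prod x ^ ((q ^ k - 1) div 3))"
proof -
  define m where "m = (q - 1) div 3"
  have q: "q = 3 * m + 1" using q_sub_1 q_gt_1 by (simp add: m_def)
  have geo: "(\<Sum>i<k. q ^ i) * (3 * m) + 1 = q ^ k" for k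
    by (induction k) (simp_all add: q algebra_simps)
  have "poly (conj_poly k x) c = (c - x) ^ (\<Sum>i<k. q ^ i)" if c: "c \<in> C" for c
  proof -
    have "poly (conj_poly k x) c = (\<Prod>i<k. c ^ (q ^ i) - x ^ (q ^ i))"
      using c C_fixed fixed_power_q by (auto simp: conj_poly_def poly_prod intro!: prod.cong)
    also have "\<dots> = (\<Prod>i<k. (c - x) ^ (q ^ i))"
    proof (intro prod.cong refl)
      fix i show "c ^ (q ^ i) - x ^ (q ^ i) = (c - x) ^ (q ^ i)"
        by (induction i) (simp_all add: power_mult[of _ _ q] mult.commute[of q] frob_diff[symmetric])
    qed
    finally show ?thesis by (simp add: power_sum)
  qed
  hence "resultant_power (conj_poly k x) = (\<Prod>c\<in>C. ((c - x) ^ e c) ^ (\<Sum>i<k. q ^ i))"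
    unfolding resultant_power_def
    by (intro prod.cong) (simp_all add: mult.commute flip: power_mult)
  hence "resultant_power (conj_poly k x) = shift_prod x ^ (\<Sum>i<k. q ^ i)"
    by (simp add: shift_prod_def prod_power_distrib)
  moreover have "(\<Sum>i<k. q ^ i) * m = (q ^ k - 1) div 3"
    using geo[of k] by (metis add_diff_cancel_right' mult.left_commute nonzero_mult_div_cancel_left zero_neq_numeral)
  ultimately show ?thesis by (simp add: L_char_def cubic_char_def m_def flip: power_mult)
qed

text \<open>Double counting of the triples (k, x, g) with \<open>conj_poly k x dvd g\<close>,
  weighted by \<open>L_char g\<close>. Writing \<open>g\<close> as \<open>conj_poly k x\<close>
  times a monic cofactor gives the right-hand side; fixing \<open>g\<close> first counts it
  \<open>n\<close> times.\<close>

lemma newton_identity: "of_nat n * L_coeff n = (\<Sum>k=1..n. ext_sum k * L_coeff (n - k))"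
proof -
  define P where "P = (SIGMA k:{1..n}. {x::'k. x ^ (q ^ k) = x})"
  have fin_fixed: "finite {x::'k. x ^ (q ^ k) = x}" if "k \<in> {1..n}" for k
  proof -
    interpret R: frobenius "TYPE('k)" "q ^ k" by (rule frobenius_power) (use that in auto)
    show ?thesis using R.finite_fixed by (simp add: R.fixed_def)
  qed
  hence fin_P: "finite P" unfolding P_def by (intro finite_SigmaI) auto
  have "(\<Sum>k=1..n. ext_sum k * L_coeff (n - k)) =
        (\<Sum>k=1..n. \<Sum>x | x ^ (q ^ k) = x. L_char (conj_poly k x) * L_coeff (n - k))"
    by (intro sum.cong refl) (simp add: ext_sum_def sum_distrib_right L_char_conj_poly)
  also have "\<dots> = (\<Sum>(k, x)\<in>P. L_char (conj_poly k x) * L_coeff (n - k))"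
    unfolding P_def using fin_fixed by (intro sum.Sigma) auto
  also have "\<dots> = (\<Sum>y\<in>P. \<Sum>g | g \<in> monic_polys n \<and> conj_poly (fst y) (snd y) dvd g. L_char g)"
  proof (intro sum.cong refl)
    fix y assume y: "y \<in> P"
    obtain k x where kx: "y = (k, x)" by (cases y)
    have k: "k \<ge> 1" "k \<le> n" "x ^ (q ^ k) = x" using y by (auto simp: P_def kx)
    have p: "conj_poly k x \<in> monic_polys k" by (rule conj_poly_monic[OF k(3,1)])
    have "(\<Sum>g | g \<in> monic_polys n \<and> conj_poly k x dvd g. L_char g)
        = (\<Sum>h\<in>monic_polys (n - k). L_char (conj_poly k x * h))"
      by (rule sum.reindex_bij_betw[symmetric, OF bij_betw_monic_mult[OF p k(2)]])
    also have "\<dots> = L_char (conj_poly k x) * L_coeff (n - k)"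
      unfolding L_coeff_def sum_distrib_left
      using p by (intro sum.cong refl L_char_mult) (auto simp: monic_polys_def)
    finally show "(case y of (k, x) \<Rightarrow> L_char (conj_poly k x) * L_coeff (n - k)) =
        (\<Sum>g | g \<in> monic_polys n \<and> conj_poly (fst y) (snd y) dvd g. L_char g)" by (simp add: kx)
  qed
  also have "\<dots> = (\<Sum>g\<in>monic_polys n. \<Sum>y | y \<in> P \<and> conj_poly (fst y) (snd y) dvd g. L_char g)"
    using fin_P by (intro sum.swap_restrict) auto
  also have "\<dots> = (\<Sum>g\<in>monic_polys n. of_nat n * L_char g)"
  proof (intro sum.cong refl)
    fix g assume g: "g \<in> monic_polys n"
    have "{y. y \<in> P \<and> conj_poly (fst y) (snd y) dvd g} =
        {(k, x). k \<in> {1..n} \<and> x ^ (q ^ k) = x \<and> conj_poly k x dvd g}"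
      by (auto simp: P_def)
    thus "(\<Sum>y | y \<in> P \<and> conj_poly (fst y) (snd y) dvd g. L_char g) = of_nat n * L_char g"
      using conj_poly_total_count[OF g] by simp
  qed
  finally show ?thesis by (simp add: L_coeff_def sum_distrib_left)
qed

text \<open>At most \<open>(q - 1) div 3\<close> elements satisfy u^((q-1)/3) = 1. For any other
  nonzero \<open>u\<close> this power is a primitive cube root of unity, so its square is not 1
  either; one \<open>u\<close> serves both exponents.\<close>

lemma chi_nontrivial: "\<exists>u\<in>fixed. \<forall>i. (i = 1 \<or> i = 2) \<longrightarrow> u \<noteq> 0 \<and> cubic_char (u ^ i) \<noteq> 1"
proof -
  define m where "m = (q - 1) div 3"
  have m: "3 * m = q - 1" "m > 0" using q_sub_1 q_ge by (auto simp: m_def)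
  define P :: "'k poly" where "P = Polynomial.monom 1 m - 1"
  have "poly.coeff P m = 1" using m by (simp add: P_def)
  hence "P \<noteq> 0" by auto
  have "Polynomial.degree P \<le> m" unfolding P_def
    by (intro degree_diff_le) (auto simp: degree_monom_le)
  hence card: "card {x. poly P x = 0} \<le> m" using card_poly_roots_bound[OF \<open>P \<noteq> 0\<close>] by linarith
  have "card (fixed - {0}) = q - 1" by (simp add: card_fixed)
  hence "\<not> fixed - {0} \<subseteq> {x. poly P x = 0}"
    using card_mono[OF poly_roots_finite[OF \<open>P \<noteq> 0\<close>], of "fixed - {0}"] card m by linarith
  then obtain u where u: "u \<in> fixed" "u \<noteq> 0" "u ^ m \<noteq> 1"
    by (auto simp: P_def poly_monom)
  define y where "y = u ^ m"
  have y3: "y ^ 3 = 1" using fixed_power_third[OF u(1)] u by (auto simp: y_def m_def)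
  have z1: "cis (2 * pi / 3) \<noteq> 1" using sin_120 by (auto simp: complex_eq_iff)
  hence z: "cis (2 * pi / 3) \<noteq> 1" "cis (2 * pi / 3) ^ 2 \<noteq> 1"
    using cis_cube by (auto simp: power3_eq_cube power2_eq_square)
  have ne1: "chi z \<noteq> 1" if "z ^ 3 = 1" "z \<noteq> 1" for z
    using cube_root_cases[OF that(1)] that(2) z by (auto simp: chi_w chi_w2)
  have "y\<^sup>2 \<noteq> 1" using y3 u by (auto simp: power3_eq_cube power2_eq_square y_def)
  have "chi (y ^ i) \<noteq> 1" if "i = 1 \<or> i = 2" for i
  proof (rule ne1)
    show "(y ^ i) ^ 3 = 1" by (metis y3 power_one power_mult mult.commute)
    show "y ^ i \<noteq> 1" using that u(3) \<open>y\<^sup>2 \<noteq> 1\<close> by (auto simp: y_def)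
  qed
  thus ?thesis using u by (intro bexI[of _ u]) (auto simp: y_def m_def cubic_char_def mult.commute simp flip: power_mult)
qed

text \<open>Adding a multiple of the Lagrange polynomial \<open>l\<close>, of degree below
  \<open>n\<close>, multiplies the value at \<open>c0\<close> by \<open>u\<close> and keeps the
  values at the other points. This permutes the monic polynomials of degree \<open>n\<close> and
  multiplies \<open>L_coeff n\<close> by a number other than 1.\<close>

lemma L_coeff_eq_0:
  assumes n: "n \<ge> card C"
  shows "L_coeff n = 0"
proof -
  obtain c0 where c0: "c0 \<in> C" using C_ne by auto
  obtain u where u: "u \<in> fixed" "u \<noteq> 0" "cubic_char (u ^ e c0) \<noteq> 1"
    using chi_nontrivial e[OF c0] by blast
  define l where "l = (\<Prod>c\<in>C - {c0}. Polynomial.smult (1 / (c0 - c)) [:-c, 1:])"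
  have l_fixed: "l \<in> fixed_poly"
    unfolding l_def using C_fixed c0
    by (intro fixed_poly_prod fixed_poly_smult fixed_divide fixed_diff fixed_poly_linear fixed_uminus fixed_1) auto
  have "poly l c0 = (\<Prod>c\<in>C - {c0}. 1)"
    unfolding l_def poly_prod by (intro prod.cong) (auto simp: divide_simps)
  hence l_c0: "poly l c0 = 1" by simp
  have l_c: "poly l c = 0" if "c \<in> C" "c \<noteq> c0" for c
    using that by (auto simp: l_def poly_prod intro!: bexI[of _ c])
  have "Polynomial.degree l \<le> (\<Sum>c\<in>C - {c0}. 1)"
    unfolding l_def by (intro degree_prod_sum_le[THEN order.trans] sum_mono) auto
  also have "\<dots> < n" using n c0 card_gt_0_iff[of C] by auto
  finally have deg_l: "Polynomial.degree l < n" .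
  define T where "T g = g + Polynomial.smult ((u - 1) * poly g c0) l" for g
  have T_c0: "poly (T g) c0 = u * poly g c0" for g by (simp add: T_def l_c0 algebra_simps)
  have T_c: "poly (T g) c = poly g c" if "c \<in> C" "c \<noteq> c0" for g c by (simp add: T_def l_c that)
  have T_in: "T g \<in> monic_polys n" if g: "g \<in> monic_polys n" for g
  proof -
    have "Polynomial.degree (Polynomial.smult ((u - 1) * poly g c0) l) < n"
      using deg_l by (rule le_less_trans[OF degree_smult_le])
    hence "Polynomial.degree (T g) = n"
      using g by (simp add: T_def monic_polys_def degree_add_eq_left)
    moreover have "poly.coeff g n = 1" using g unfolding monic_polys_def by blast
    hence "poly.coeff (T g) n = 1" using deg_l by (simp add: T_def coeff_eq_0)
    moreover have "T g \<in> fixed_poly"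
      using g u c0 C_fixed l_fixed unfolding T_def monic_polys_def
      by (intro fixed_poly_add fixed_poly_smult fixed_mult fixed_diff poly_fixed) auto
    ultimately show ?thesis by (simp add: monic_polys_def)
  qed
  have "inj_on T (monic_polys n)"
  proof (rule inj_onI)
    fix g h assume "T g = T h"
    moreover from this have "poly g c0 = poly h c0" using T_c0[of g] T_c0[of h] u by simp
    ultimately show "g = h" by (simp add: T_def)
  qed
  moreover from this have "T ` monic_polys n = monic_polys n"
    using T_in by (intro endo_inj_surj) auto
  ultimately have bij: "bij_betw T (monic_polys n) (monic_polys n)" by (simp add: bij_betw_def)
  let ?a = "cubic_char (u ^ e c0)"
  have lam_T: "L_char (T g) = ?a * L_char g" if g: "g \<in> monic_polys n" for g
  proof -
    have "resultant_power (T g) = u ^ e c0 * resultant_power g"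
      using c0 by (simp add: resultant_power_def prod.remove[of C c0] T_c0 T_c power_mult_distrib)
    moreover have "resultant_power g \<in> fixed" using g resultant_power_fixed by (auto simp: monic_polys_def)
    ultimately show ?thesis
      using u by (simp add: L_char_def cubic_char_mult)
  qed
  have "L_coeff n = (\<Sum>g\<in>monic_polys n. L_char (T g))"
    unfolding L_coeff_def by (rule sum.reindex_bij_betw[OF bij, symmetric])
  also have "\<dots> = ?a * L_coeff n" by (simp add: L_coeff_def sum_distrib_left lam_T)
  finally have "(1 - ?a) * L_coeff n = 0" by (simp add: algebra_simps)
  thus ?thesis using u(3) by simp
qed

theorem weil_bound:
  "norm (\<Sum>x\<in>fixed. cubic_char (shift_prod x)) \<le> real (card C - 1) * sqrt (real q)"
proof -
  obtain B where B: "\<And>k. k \<ge> 1 \<Longrightarrow> norm (ext_sum (2 * k)) \<le> B * real q ^ k" using ext_sum_bound by blast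
  have "norm (ext_sum 1) \<le> real (card C - 1) * sqrt (real q)"
  proof (rule newton_bound[where s = L_coeff])
    show "card C \<ge> 1" using C_ne card_gt_0_iff[of C] by simp
  qed (use L_coeff_0 L_coeff_eq_0 newton_identity B q_gt_1 in auto)
  thus ?thesis by (simp add: ext_sum_def fixed_def cubic_char_def)
qed

end

section \<open>Five translates of the cubes\<close>

lemma sum_Pow_by_card:
  assumes "finite C"
  shows "(\<Sum>Y\<in>Pow C. f (card Y)) = (\<Sum>k\<le>card C. of_nat (card C choose k) * (f k :: 'a::semiring_1))"
proof -
  have "(\<Sum>Y\<in>Pow C. f (card Y)) = (\<Sum>k\<le>card C. \<Sum>Y | Y \<in> Pow C \<and> card Y = k. f (card Y))"
    using assms by (intro sum.group[symmetric]) (auto intro: card_mono)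
  also have "\<dots> = (\<Sum>k\<le>card C. of_nat (card C choose k) * f k)"
    using n_subsets[OF assms] by (intro sum.cong refl) simp
  finally show ?thesis .
qed

context cubic_frobenius
begin

lemma norm_sum_prod_cubic_char:
  assumes "q \<ge> 16" "Y \<subseteq> fixed" "Y \<noteq> {}" "\<And>c. c \<in> Y \<Longrightarrow> e c = 1 \<or> e c = 2"
  shows "norm (\<Sum>x\<in>fixed. \<Prod>c\<in>Y. cubic_char (c - x) ^ e c) \<le> real (card Y - 1) * sqrt (real q)"
proof -
  interpret cubic_character_sum K q w Y e by unfold_locales (use assms in auto)
  have "(\<Sum>x\<in>fixed. \<Prod>c\<in>Y. cubic_char (c - x) ^ e c) = (\<Sum>x\<in>fixed. cubic_char (shift_prod x))"
  proof (intro sum.cong refl)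
    fix x assume "x \<in> fixed"
    hence "c - x \<in> fixed" if "c \<in> Y" for c using that assms(2) by (intro fixed_diff) auto
    thus "(\<Prod>c\<in>Y. cubic_char (c - x) ^ e c) = cubic_char (shift_prod x)"
      unfolding shift_prod_def by (subst cubic_char_prod) (auto simp: cubic_char_power)
  qed
  thus ?thesis using weil_bound by simp
qed

text \<open>The factor \<open>b c x + 2\<close> vanishes when \<open>c - x\<close> is a nonzero
  cube. If every \<open>x\<close> fails, only \<open>x\<close> in \<open>C\<close> contributes to
  the sum of products, at most 5 * 4^5 = 5120, against a main term of \<open>32 * q\<close>.\<close>

lemma exists_noncube_translates:
  assumes C: "C \<subseteq> fixed" "card C = 5" and q: "q > 2809"
  shows "\<exists>x\<in>fixed. \<forall>c\<in>C. c \<noteq> x \<and> (c - x) ^ ((q - 1) div 3) \<noteq> 1"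
proof (rule ccontr)
  assume contra: "\<not> ?thesis"
  have fin: "finite C" using C by (simp add: card_ge_0_finite)
  define h where "h c x = cubic_char (c - x)" for c x
  define b where "b c x = - (h c x + h c x ^ 2)" for c x
  have norm_h: "norm (h c x) \<le> 1" for c x by (simp add: h_def cubic_char_def norm_chi)
  have norm_factor: "norm (b c x + 2) \<le> 4" for c x
  proof -
    have "norm (b c x + 2) \<le> norm (b c x) + 2" using norm_triangle_ineq[of "b c x" 2] by simp
    also have "norm (b c x) \<le> norm (h c x) + norm (h c x) ^ 2"
      unfolding b_def norm_minus_cancel norm_power[symmetric] by (rule norm_triangle_ineq)
    also have "\<dots> \<le> 1 + 1" using norm_h by (intro add_mono power_le_one) auto
    finally show ?thesis by simp
  qed
  have upper: "norm (\<Sum>x\<in>fixed. \<Prod>c\<in>C. b c x + 2) \<le> 5120"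
  proof -
    have "(\<Prod>c\<in>C. b c x + 2) = 0" if x: "x \<in> fixed - C" for x
    proof -
      obtain c where c: "c \<in> C" "(c - x) ^ ((q - 1) div 3) = 1" using contra x by auto
      hence "b c x + 2 = 0" by (simp add: b_def h_def cubic_char_def)
      thus ?thesis using c fin by (meson prod_zero)
    qed
    hence "(\<Sum>x\<in>fixed. \<Prod>c\<in>C. b c x + 2) = (\<Sum>x\<in>C. \<Prod>c\<in>C. b c x + 2)"
      using C by (intro sum.mono_neutral_right) auto
    also have "norm \<dots> \<le> real (card C) * 4 ^ card C"
    proof (rule sum_norm_bound)
      fix x
      have "norm (\<Prod>c\<in>C. b c x + 2) \<le> (\<Prod>c\<in>C. 4)"
        unfolding prod_norm[symmetric] using norm_factor by (intro prod_mono) auto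
      thus "norm (\<Prod>c\<in>C. b c x + 2) \<le> 4 ^ card C" by simp
    qed
    finally show ?thesis using C by simp
  qed
  \<comment> \<open>The empty \<open>Y\<close> yields 2^5 q. A \<open>Y\<close> of size k has 2^k
    exponent patterns, each with a sum of size at most (k - 1) sqrt q, times the remaining 2^(5-k).
    The total over \<open>Y\<close> is 32 * (10 + 20 + 15 + 4) = 32 * 49 = 1568.\<close>
  have lower: "norm ((\<Sum>x\<in>fixed. \<Prod>c\<in>C. b c x + 2) - 32 * of_nat q) \<le> 1568 * sqrt (real q)"
  proof -
    have "(\<Sum>x\<in>fixed. \<Prod>c\<in>C. b c x + 2) = (\<Sum>x\<in>fixed. \<Sum>Y\<in>Pow C. (\<Prod>c\<in>Y. b c x) * (\<Prod>c\<in>C - Y. 2))"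
      using fin by (intro sum.cong refl prod_add)
    also have "\<dots> = (\<Sum>Y\<in>Pow C. (\<Sum>x\<in>fixed. \<Prod>c\<in>Y. b c x) * 2 ^ (5 - card Y))"
      using C fin by (subst sum.swap) (intro sum.cong refl, auto simp: sum_distrib_right card_Diff_subset finite_subset)
    also have "\<dots> = 32 * of_nat q + (\<Sum>Y\<in>Pow C - {{}}. (\<Sum>x\<in>fixed. \<Prod>c\<in>Y. b c x) * 2 ^ (5 - card Y))"
      using fin by (subst sum.remove[of _ "{}"]) (auto simp: card_fixed)
    finally have "norm ((\<Sum>x\<in>fixed. \<Prod>c\<in>C. b c x + 2) - 32 * of_nat q)
      = norm (\<Sum>Y\<in>Pow C - {{}}. (\<Sum>x\<in>fixed. \<Prod>c\<in>Y. b c x) * 2 ^ (5 - card Y))" by simp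
    also have "\<dots> \<le> (\<Sum>Y\<in>Pow C - {{}}. 32 * sqrt (real q) * real (card Y - 1))"
    proof (rule sum_norm_le)
      fix Y assume Y: "Y \<in> Pow C - {{}}"
      have finY: "finite Y" and Y5: "card Y \<le> 5" using Y fin C card_mono[of C Y] by (auto intro: finite_subset)
      have "(\<Sum>x\<in>fixed. \<Prod>c\<in>Y. b c x) = (\<Sum>x\<in>fixed. \<Prod>c\<in>Y. \<Sum>j\<in>{1, 2::nat}. - (h c x ^ j))"
        by (simp add: b_def)
      also have "\<dots> = (\<Sum>x\<in>fixed. \<Sum>e\<in>Y \<rightarrow>\<^sub>E {1, 2}. \<Prod>c\<in>Y. - (h c x ^ e c))"
        using finY by (intro sum.cong refl prod_sum_PiE) auto
      also have "\<dots> = (\<Sum>e\<in>Y \<rightarrow>\<^sub>E {1, 2}. (-1) ^ card Y * (\<Sum>x\<in>fixed. \<Prod>c\<in>Y. h c x ^ e c))"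
        by (subst sum.swap) (simp add: sum_distrib_left prod_uminus)
      also have "norm \<dots> \<le> real (card (Y \<rightarrow>\<^sub>E {1, 2::nat})) * (real (card Y - 1) * sqrt (real q))"
      proof (rule sum_norm_bound)
        fix e assume e: "e \<in> Y \<rightarrow>\<^sub>E {1, 2::nat}"
        show "norm ((-1) ^ card Y * (\<Sum>x\<in>fixed. \<Prod>c\<in>Y. h c x ^ e c)) \<le> real (card Y - 1) * sqrt (real q)"
          unfolding norm_mult norm_power h_def
          using norm_sum_prod_cubic_char[of Y e] Y C q PiE_mem[OF e] by auto
      qed
      also have "card (Y \<rightarrow>\<^sub>E {1, 2::nat}) = 2 ^ card Y" using finY by (simp add: card_PiE numeral_2_eq_2)
      finally have "norm (\<Sum>x\<in>fixed. \<Prod>c\<in>Y. b c x) * 2 ^ (5 - card Y)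
          \<le> real (2 ^ card Y) * (real (card Y - 1) * sqrt (real q)) * 2 ^ (5 - card Y)"
        by (intro mult_right_mono) auto
      also have "\<dots> = 2 ^ (card Y + (5 - card Y)) * (real (card Y - 1) * sqrt (real q))"
        unfolding power_add by simp
      also have "\<dots> = 32 * sqrt (real q) * real (card Y - 1)" using Y5 by simp
      finally show "norm ((\<Sum>x\<in>fixed. \<Prod>c\<in>Y. b c x) * 2 ^ (5 - card Y)) \<le> 32 * sqrt (real q) * real (card Y - 1)"
        by (simp add: norm_mult norm_power)
    qed
    \<comment> \<open>The empty set may return because truncated subtraction gives it weight
      0.\<close>
    also have "\<dots> = (\<Sum>Y\<in>Pow C. 32 * sqrt (real q) * real (card Y - 1))"
      using fin by (intro sum.mono_neutral_left) auto
    also have "\<dots> = 32 * sqrt (real q) * (\<Sum>k\<le>5. real (5 choose k) * real (k - 1))"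
      using sum_Pow_by_card[OF fin, of "\<lambda>k. real (k - 1)"] C by (simp add: sum_distrib_left[symmetric])
    also have "(\<Sum>k\<le>5. real (5 choose k) * real (k - 1)) = 49"
      by (simp add: numeral_eq_Suc)
    finally show ?thesis by simp
  qed
  have "32 * real q = norm (32 * of_nat q :: complex)" by (simp add: norm_mult)
  also have "\<dots> \<le> 5120 + 1568 * sqrt (real q)"
    using norm_triangle_ineq4[of "\<Sum>x\<in>fixed. \<Prod>c\<in>C. b c x + 2" "(\<Sum>x\<in>fixed. \<Prod>c\<in>C. b c x + 2) - 32 * of_nat q"]
      upper lower by simp
  \<comment> \<open>Since 2809 = 53^2, q exceeds 53 sqrt q, and the inequality would force 4 sqrt q
    < 160.\<close>
  finally have "real q \<le> 160 + 49 * sqrt (real q)" by simp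
  moreover have "sqrt (real q) > 53" using q by (intro real_less_rsqrt) simp
  hence "sqrt (real q) * 53 < sqrt (real q) * sqrt (real q)" using q by (intro mult_strict_left_mono) auto
  ultimately show False using \<open>sqrt (real q) > 53\<close> by simp
qed

end

section \<open>From the finite field to its algebraic closure\<close>

lemma finite_field_power_card:
  fixes x :: "'a::{finite,field}"
  shows "x ^ card (UNIV :: 'a set) = x"
proof (cases "x = 0")
  case False
  let ?U = "UNIV - {0 :: 'a}"
  have "bij_betw (\<lambda>y. x * y) ?U ?U"
    by (rule bij_betw_byWitness[where f' = "\<lambda>y. y / x"]) (use False in auto)
  hence "(\<Prod>y\<in>?U. x * y) = \<Prod>?U" using prod.reindex_bij_betw[of "\<lambda>y. x * y" ?U ?U "\<lambda>y. y"] by simp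
  hence "x ^ card ?U * \<Prod>?U = \<Prod>?U" by (simp add: prod.distrib)
  moreover have "\<Prod>?U \<noteq> 0" by (simp add: prod_zero_iff)
  ultimately have "x ^ card ?U = 1" by simp
  moreover have "card (UNIV :: 'a set) = Suc (card ?U)"
    by (rule card.remove) auto
  ultimately show ?thesis by (simp only: power_Suc mult_1_right)
qed (simp add: card_gt_0_iff)

text \<open>Additivity is obtained without the characteristic: (X + 1)^q - X^q - 1 has degree below
  \<open>q\<close> and vanishes at all \<open>q\<close> elements of the finite field, so it is zero.
  The middle binomial coefficients therefore vanish there, hence also in the closure.\<close>

lemma frobenius_alg_closure:
  "frobenius TYPE('a::{finite,field} alg_closure) (card (UNIV :: 'a set))"
proof -
  let ?q = "card (UNIV :: 'a set)"
  have "card {0, 1 :: 'a} \<le> ?q" by (rule card_mono) auto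
  hence q: "?q > 1" by simp
  \<comment> \<open>Translation by 1 permutes the field, so adding up all elements shows that
    \<open>q\<close> copies of 1 sum to 0.\<close>
  have "(\<Sum>x\<in>UNIV. x + 1 :: 'a) = (\<Sum>x\<in>UNIV. x)"
    by (rule sum.reindex_bij_witness[of _ "\<lambda>x. x - 1" "\<lambda>x. x + 1"]) auto
  hence q0: "of_nat ?q = (0 :: 'a)" by (simp add: sum.distrib)
  define P where "P = (\<Sum>i\<in>{1..<?q}. Polynomial.monom (of_nat (?q choose i) :: 'a) i)"
  have split: "(\<Sum>i\<le>?q. f i) = f 0 + f ?q + (\<Sum>i\<in>{1..<?q}. f i)" for f :: "nat \<Rightarrow> 'b::comm_monoid_add"
  proof -
    have "{..?q} = insert 0 (insert ?q {1..<?q})" using q by auto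
    thus ?thesis using q by (simp add: add.assoc)
  qed
  have "poly P x = 0" for x
  proof -
    have "(x + 1) ^ ?q = (\<Sum>i\<le>?q. of_nat (?q choose i) * x ^ i)" by (simp add: binomial_ring)
    also have "\<dots> = 1 + x ^ ?q + poly P x" by (simp add: split P_def poly_sum poly_monom)
    finally show ?thesis by (simp add: finite_field_power_card)
  qed
  moreover have "Polynomial.degree P < ?q"
  proof -
    have "Polynomial.degree P \<le> ?q - 1" unfolding P_def
      by (rule degree_sum_le) (auto intro: order.trans[OF degree_monom_le])
    thus ?thesis using q by linarith
  qed
  ultimately have "P = 0" using card_poly_roots_bound[of P] by fastforce
  have binom: "of_nat (?q choose i) = (0 :: 'a alg_closure)" if i: "i \<in> {1..<?q}" for i
  proof -
    have "poly.coeff P i = of_nat (?q choose i)"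
      using i by (simp add: P_def coeff_sum sum.delta)
    hence "of_nat (?q choose i) = (0 :: 'a)" using \<open>P = 0\<close> by simp
    hence "to_ac (of_nat (?q choose i) :: 'a) = 0" by simp
    thus ?thesis by simp
  qed
  show ?thesis
  proof
    fix x y :: "'a alg_closure"
    have "(x + y) ^ ?q = (\<Sum>i\<le>?q. of_nat (?q choose i) * x ^ i * y ^ (?q - i))" by (rule binomial_ring)
    also have "\<dots> = x ^ ?q + y ^ ?q" by (simp add: split binom)
    finally show "(x + y) ^ ?q = x ^ ?q + y ^ ?q" .
  next
    have "to_ac (of_nat ?q :: 'a) = 0" using q0 by simp
    thus "of_nat ?q = (0 :: 'a alg_closure)" by simp
  qed (rule q)
qed

theorem theorem2p4:
  fixes q :: nat
  assumes "card (UNIV :: 'a::{finite,field} set) = q"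
    and "q mod 4 = 1"
    and "3 dvd (q - 1)"
    and "q > 2809"
  shows "\<exists>x::'a. \<not> (\<exists>\<alpha> \<beta>. \<alpha> \<in> potents 5 \<and> \<beta> \<in> potents (1 + (q - 1) div 3) \<and> x = \<alpha> + \<beta>)"
proof -
  have frob: "frobenius TYPE('a alg_closure) q"
    using frobenius_alg_closure[where 'a = 'a] assms(1) by simp
  have "Polynomial.degree [:1, 1, 1 :: 'a alg_closure:] > 0" by simp
  then obtain w :: "'a alg_closure" where "poly [:1, 1, 1:] w = 0"
    using alg_closed_imp_poly_has_root by blast
  hence w: "w\<^sup>2 + w + 1 = 0" by (simp add: algebra_simps power2_eq_square)
  have q3: "q mod 3 = 1" using assms(3,4) by presburger
  interpret cubic_frobenius "TYPE('a alg_closure)" q w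
    using frob w q3 by (simp add: cubic_frobenius_def cubic_frobenius_axioms_def)
  have range_fixed: "range (to_ac :: 'a \<Rightarrow> _) = fixed"
  proof (rule card_subset_eq)
    show "range (to_ac :: 'a \<Rightarrow> _) \<subseteq> fixed"
      using finite_field_power_card[where 'a = 'a] assms(1)
      by (auto simp: fixed_def simp flip: to_ac_power)
    show "card (range (to_ac :: 'a \<Rightarrow> _)) = card fixed"
      using assms(1) by (simp add: card_image inj_to_ac card_fixed)
  qed simp
  let ?p = "Polynomial.monom 1 5 - [:0, 1 :: 'a:]"
  have p_coeff: "poly.coeff ?p 5 = 1" by (simp add: coeff_pCons split: nat.splits)
  hence "?p \<noteq> 0" by force
  have "Polynomial.degree ?p \<le> 5" by (intro degree_diff_le) (auto simp: degree_monom_eq)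
  moreover have "potents 5 = {x. poly ?p x = 0}" by (auto simp: potents_def poly_monom)
  ultimately have "card (potents 5 :: 'a set) \<le> 5"
    using card_poly_roots_bound[OF \<open>?p \<noteq> 0\<close>] by simp
  hence "card (to_ac ` (potents 5 :: 'a set)) \<le> 5"
    by (meson card_image_le finite order.trans)
  \<comment> \<open>Padding to exactly five points; avoiding cubes at the extra ones as well does no
    harm.\<close>
  then obtain C where C: "to_ac ` (potents 5 :: 'a set) \<subseteq> C" "C \<subseteq> fixed" "card C = 5"
    using exists_subset_between[of "to_ac ` (potents 5 :: 'a set)" 5 fixed] range_fixed card_fixed assms(4)
    by auto
  obtain y where y: "y \<in> fixed" "\<And>c. c \<in> C \<Longrightarrow> c \<noteq> y \<and> (c - y) ^ ((q - 1) div 3) \<noteq> 1"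
    using exists_noncube_translates[OF C(2,3) assms(4)] by blast
  obtain z :: 'a where z: "y = to_ac z" using y(1) range_fixed by blast
  have noncube: "\<alpha> \<noteq> z \<and> (\<alpha> - z) ^ ((q - 1) div 3) \<noteq> 1" if "\<alpha> \<in> potents 5" for \<alpha> :: 'a
    using y(2)[of "to_ac \<alpha>"] C(1) that by (auto simp: z simp flip: to_ac_diff to_ac_power to_ac_1)
  \<comment> \<open>The witness is \<open>- z\<close>: if it were \<alpha> + \<beta>, then \<beta>
    would be the difference of \<open>- \<alpha>\<close> and \<open>z\<close>. As 5 is odd,
    \<open>- \<alpha>\<close> lies in \<open>potents 5\<close> again, and \<open>noncube\<close>
    excludes that this difference is 0 or a cube.\<close>
  have "- z \<noteq> \<alpha> + \<beta>" if "\<alpha> \<in> potents 5" "\<beta> \<in> potents (1 + (q - 1) div 3)" for \<alpha> \<beta> :: 'a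
  proof
    assume "- z = \<alpha> + \<beta>"
    hence "z = - (\<alpha> + \<beta>)" by (metis minus_minus)
    hence \<beta>: "\<beta> = - \<alpha> - z" by simp
    have "- \<alpha> \<in> potents 5" using that(1) by (simp add: potents_def)
    moreover have "\<beta> = 0 \<or> \<beta> ^ ((q - 1) div 3) = 1" using that(2) by (auto simp: potents_def)
    ultimately show False using noncube[of "- \<alpha>"] \<beta> by auto
  qed
  thus ?thesis by blast
qed

end
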